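(* Let $w$ be the cut-vertex of a bouquet $B_m$ of $m$ cycles $C^1,\ldots,C^m$, $m \ge 2$, and let $b$ be the number of the cycles isomorphic to $C_3$ in $B_m$. For each $j \in\{1,2,\ldots,m\}$, let $\Gamma_j=V(C^j)-N[w]$ and $D_j=\{v\in V(C^j): d(v,w)=\mathrm{diam}(C^j)\}$. Let $v \in V(C^i) \subset V(B_m)$ for some $i \in \{1,2,\ldots,m\}$. Then $$\mathrm{cdim}_{B_m}(v)=\begin{cases} \mathrm{cdim}(B_m) & \text{if } v \in N[w],\\ \mathrm{cdim}(B_m)+d(v,w)-1 & \text{if } v\in \Gamma_i \text{ and } b=m-1, \text{ or } v\in \Gamma_i-D_i \text{ and } b \le m-2,\\ \mathrm{cdim}(B_m)+d(v,w)-2 & \text{if } v\in \Gamma_i \cap D_i \text{ and } b \le m-2. \end{cases}$$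
   Context: A bouquet $B_m$ of $m$ cycles is the vertex sum of $m$ cycles $C^1,\ldots,C^m$ (each of length at least three) at one common vertex $w$, i.e. the graph obtained from $m$ disjoint cycles by identifying one vertex of each into the single vertex $w$; $w$ is its cut-vertex. $N[w]$ is the closed neighborhood of $w$ in $B_m$; $d$ is the shortest-path distance and $\mathrm{diam}(C^j)$ is the diameter of the cycle $C^j$. A set $S\subseteq V(G)$ is a resolving set of a connected graph $G$ if for every pair of distinct vertices $x,y$ of $G$ there is $z\in S$ with $d(x,z)\ne d(y,z)$; it is a connected resolving set if moreover the induced subgraph $G[S]$ is connected. $\mathrm{cdim}(G)$ is the minimum cardinality of a connected resolving set of $G$, and $\mathrm{cdim}_G(v)$ is the minimum cardinality of a connected resolving set containing $v$. *)

theory Defs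
  imports "Graph_Theory.Graph_Theory"
begin

text \<open>
  Simple graphs are symmetric loop-free \<open>pair_pre_digraph\<close>s: an edge \<open>uv\<close> is the pair of
  arcs \<open>(u, v)\<close>, \<open>(v, u)\<close>.
\<close>

text \<open>
  For vertices that are not joined by a walk the value is unspecified; bouquets are connected.
\<close>
definition gdist :: "'a pair_pre_digraph \<Rightarrow> 'a \<Rightarrow> 'a \<Rightarrow> nat" where
  "gdist G u v = (LEAST n. \<exists>p. pre_digraph.awalk (with_proj G) u p v \<and> length p = n)"

definition diam :: "'a pair_pre_digraph \<Rightarrow> nat" where
  "diam G = Max {gdist G u v |u v. u \<in> pverts G \<and> v \<in> pverts G}"

definition closed_nbhd :: "'a pair_pre_digraph \<Rightarrow> 'a \<Rightarrow> 'a set" where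
  "closed_nbhd G u = insert u {v. (u, v) \<in> parcs G}"

definition resolving_set :: "'a pair_pre_digraph \<Rightarrow> 'a set \<Rightarrow> bool" where
  "resolving_set G S \<longleftrightarrow> S \<subseteq> pverts G \<and>
    (\<forall>x\<in>pverts G. \<forall>y\<in>pverts G. x \<noteq> y \<longrightarrow> (\<exists>z\<in>S. gdist G x z \<noteq> gdist G y z))"

definition connected_resolving_set :: "'a pair_pre_digraph \<Rightarrow> 'a set \<Rightarrow> bool" where
  "connected_resolving_set G S \<longleftrightarrow>
    resolving_set G S \<and> Digraph_Component.connected (with_proj G \<restriction> S)"

definition cdim :: "'a pair_pre_digraph \<Rightarrow> nat" where
  "cdim G = (LEAST k. \<exists>S. connected_resolving_set G S \<and> card S = k)"

definition cdim_at :: "'a pair_pre_digraph \<Rightarrow> 'a \<Rightarrow> nat" where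
  "cdim_at G v = (LEAST k. \<exists>S. connected_resolving_set G S \<and> v \<in> S \<and> card S = k)"

text \<open>
  \<open>is_cycle n C\<close>: the graph \<open>C\<close> is isomorphic to \<open>C\<^sub>n\<close>; \<open>x\<close> lists its vertices in cyclic order.
\<close>
definition is_cycle :: "nat \<Rightarrow> 'a pair_pre_digraph \<Rightarrow> bool" where
  "is_cycle n C \<longleftrightarrow> n \<ge> 3 \<and>
    (\<exists>x. bij_betw x {..<n} (pverts C) \<and>
      parcs C = (\<Union>i<n. {(x i, x (Suc i mod n)), (x (Suc i mod n), x i)}))"

text \<open>
  Identifying one vertex of each of \<open>m\<close> disjoint cycles to \<open>w\<close> amounts to having \<open>m\<close> cycles
  that pairwise share exactly the vertex \<open>w\<close> (and hence no edge), and taking their union.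
\<close>
definition bouquet ::
  "'a pair_pre_digraph \<Rightarrow> 'a \<Rightarrow> nat \<Rightarrow> (nat \<Rightarrow> 'a pair_pre_digraph) \<Rightarrow> bool" where
  "bouquet B w m C \<longleftrightarrow>
    (\<forall>j\<in>{1..m}. (\<exists>n. is_cycle n (C j)) \<and> w \<in> pverts (C j)) \<and>
    (\<forall>i\<in>{1..m}. \<forall>j\<in>{1..m}. i \<noteq> j \<longrightarrow> pverts (C i) \<inter> pverts (C j) = {w}) \<and>
    pverts B = (\<Union>j\<in>{1..m}. pverts (C j)) \<and>
    parcs B = (\<Union>j\<in>{1..m}. parcs (C j))"

lemma is_cycle_pair_graph:
  assumes "is_cycle n C"
  shows "pair_graph C"
proof -
  from assms obtain x where n: "n \<ge> 3" and x: "bij_betw x {..<n} (pverts C)"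
    and E: "parcs C = (\<Union>i<n. {(x i, x (Suc i mod n)), (x (Suc i mod n), x i)})"
    unfolding is_cycle_def by blast
  have V: "x i \<in> pverts C" if "i < n" for i
    using x that by (auto simp: bij_betw_def)
  have mod: "Suc i mod n < n" for i using n by simp
  have ne: "x i \<noteq> x (Suc i mod n)" if "i < n" for i
  proof -
    have "i \<noteq> Suc i mod n" using that n by (cases "Suc i = n") auto
    then show ?thesis using x that mod[of i] by (auto simp: bij_betw_def inj_on_def)
  qed
  have sym: "sym (parcs C)" unfolding E sym_def by blast
  show ?thesis
  proof unfold_locales
    show "finite (pverts C)" using x by (metis bij_betw_finite finite_lessThan)
    show "finite (parcs C)" unfolding E by simp
    show "symmetric (with_proj C)" using sym by (simp add: symmetric_def)
  next
    fix e assume "e \<in> parcs C"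
    then obtain i where i: "i < n"
      and e: "e = (x i, x (Suc i mod n)) \<or> e = (x (Suc i mod n), x i)"
      unfolding E by blast
    show "fst e \<in> pverts C" "snd e \<in> pverts C" "fst e \<noteq> snd e"
      using e V[OF i] V[OF mod[of i]] ne[OF i] by (elim disjE; simp)+
  qed
qed

lemma bouquet_pair_graph:
  assumes "bouquet B w m C"
  shows "pair_graph B"
proof -
  have V: "pverts B = (\<Union>j\<in>{1..m}. pverts (C j))"
    and E: "parcs B = (\<Union>j\<in>{1..m}. parcs (C j))"
    using assms by (simp_all only: bouquet_def)
  have G: "pair_graph (C j)" if j: "j \<in> {1..m}" for j
  proof -
    have "\<forall>j\<in>{1..m}. (\<exists>n. is_cycle n (C j)) \<and> w \<in> pverts (C j)"
      by (rule conjunct1[OF assms[unfolded bouquet_def]])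
    then obtain n where "is_cycle n (C j)" using j by blast
    then show ?thesis by (rule is_cycle_pair_graph)
  qed
  have fin: "finite (pverts (C j))" "finite (parcs (C j))"
    and sy: "sym (parcs (C j))"
    and wf: "e \<in> parcs (C j) \<Longrightarrow> fst e \<in> pverts (C j) \<and> snd e \<in> pverts (C j) \<and> fst e \<noteq> snd e"
    if "j \<in> {1..m}" for j e
  proof -
    interpret pair_graph "C j" using G[OF that] .
    show "finite (pverts (C j))" "finite (parcs (C j))"
      by (rule pair_finite_verts pair_finite_arcs)+
    show "sym (parcs (C j))" using pair_sym_arcs by (simp add: symmetric_def)
    show "fst e \<in> pverts (C j) \<and> snd e \<in> pverts (C j) \<and> fst e \<noteq> snd e" if "e \<in> parcs (C j)"
      using that arc_fst_in_verts arc_snd_in_verts pair_no_loops by simp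
  qed
  have sym: "sym (parcs B)"
    unfolding E using sy by (intro sym_UNION) simp
  show ?thesis
  proof unfold_locales
    show "finite (pverts B)" unfolding V using fin by (intro finite_UN_I) simp_all
    show "finite (parcs B)" unfolding E using fin by (intro finite_UN_I) simp_all
    show "symmetric (with_proj B)" using sym by (simp add: symmetric_def)
  next
    fix e assume "e \<in> parcs B"
    then obtain j where j: "j \<in> {1..m}" "e \<in> parcs (C j)"
      unfolding E by (elim UN_E)
    show "fst e \<in> pverts B" "snd e \<in> pverts B" "fst e \<noteq> snd e"
      using wf[OF j] j(1) unfolding V by (auto simp del: atLeastAtMost_iff)
  qed
qed

text \<open>
  \<open>gdist\<close> is the shortest-path distance of the library for unit weights, as a natural number.
\<close>
lemma \<mu>_eq_gdist:
  assumes "pair_wf_digraph G" and "u \<rightarrow>\<^sup>*\<^bsub>with_proj G\<^esub> v"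
  shows "wf_digraph.\<mu> (with_proj G) (\<lambda>_. 1) u v = ereal (real (gdist G u v))"
proof -
  interpret pair_wf_digraph G by fact
  have cost: "awalk_cost (\<lambda>_. 1) p = real (length p)" for p :: "('a \<times> 'a) list"
    by (induct p) auto
  let ?P = "\<lambda>n. \<exists>p. awalk u p v \<and> length p = n"
  have ex: "\<exists>n. ?P n" using assms(2) reachable_awalk by auto
  obtain p where p: "awalk u p v" "length p = gdist G u v"
    using LeastI_ex[OF ex] unfolding gdist_def by blast
  show ?thesis
  proof (rule antisym)
    show "\<mu> (\<lambda>_. 1) u v \<le> ereal (real (gdist G u v))"
      using min_cost_le_walk_cost[OF p(1), of "\<lambda>_. 1"] p(2) by (simp add: cost)
    show "ereal (real (gdist G u v)) \<le> \<mu> (\<lambda>_. 1) u v"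
      unfolding \<mu>_def
    proof (rule INF_greatest)
      fix q assume "q \<in> {p. awalk u p v}"
      then have "gdist G u v \<le> length q"
        unfolding gdist_def by (intro Least_le) auto
      then show "ereal (real (gdist G u v)) \<le> ereal (awalk_cost (\<lambda>_. 1) q)"
        by (simp add: cost)
    qed
  qed
qed

end

theory Submission
  imports Defs
begin

text \<open>
  Call a cycle of the bouquet without \<open>w\<close> a petal. Whatever lies outside a petal is seen from
  inside it through \<open>w\<close> only (\<open>gdist_through_w\<close>), so the two neighbours of \<open>w\<close> on one cycle can
  only be told apart by a landmark in that petal. Hence a connected resolving set \<open>S\<close> meets every
  petal (\<open>meets_petal\<close>), contains \<open>w\<close> because there are at least two petals, and with every
  \<open>v\<close> in a petal contains one of the two arcs from \<open>w\<close> to \<open>v\<close> (\<open>contains_arc\<close>), which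
  costs at least \<open>d(v,w)\<close> vertices there. Conversely \<open>w\<close> together with one of its neighbours on a
  cycle already separates all vertices of that cycle (\<open>eq_if_equidistant\<close>).

  Only pairs of vertices on different cycles couple the petals. A vertex \<open>u\<close> of a petal is blind
  if shortest paths from it to all landmarks of its own petal may run through \<open>w\<close>. Two vertices
  at the same distance from \<open>w\<close> on different cycles are unresolved exactly if both are blind.
  So at most one petal may contain a blind neighbour of \<open>w\<close> (\<open>blind_petal_unique\<close>), and
  it suffices that at most one petal contains any blind vertex (\<open>connected_resolvingI\<close>).
  One landmark is enough to avoid blindness on a triangle. On a longer cycle one landmark next to
  \<open>w\<close> leaves the other neighbour of \<open>w\<close> blind, whereas both neighbours of \<open>w\<close>, or an
  arc that reaches a vertex at maximal distance from \<open>w\<close>, leave nothing blind. A shorter arc leaves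
  the neighbour of \<open>w\<close> on the opposite side blind.

  A connected resolving set through a vertex \<open>v\<close> of the \<open>i\<close>-th petal at distance \<open>d\<close>
  from \<open>w\<close> therefore costs, besides \<open>w\<close>, at least \<open>d\<close> vertices in that petal and its quota
  (one for a triangle, two otherwise) in every other petal. The single tolerated blind petal
  saves one vertex in some other long cycle, provided there is one and the arc to \<open>v\<close> is not blind
  itself. This is the number \<open>cdim_through i d\<close>, which is attained (\<open>cdim_at_petal\<close>). As it is
  smallest for \<open>d = 1\<close>, \<open>cdim B = cdim_through i 1\<close> for every \<open>i\<close> (\<open>cdim_eq\<close>), and
  the three cases of the theorem compare \<open>cdim_through i d\<close> with \<open>cdim_through i 1\<close>.
\<close>

section \<open>Distances and connectedness in symmetric graphs\<close>

text \<open>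
  The Lipschitz condition bounds every walk to \<open>v\<close> from below, and following the descent
  produces a walk that attains the bound. All distances below are computed by exhibiting such an \<open>f\<close>.
\<close>
lemma gdist_eqI:
  assumes "pair_wf_digraph G"
    and v: "v \<in> pverts G" and u: "u \<in> pverts G"
    and zero: "f v = 0"
    and lip: "\<And>a b. (a, b) \<in> parcs G \<Longrightarrow> f a \<le> Suc (f b)"
    and descent: "\<And>a. a \<in> pverts G \<Longrightarrow> a \<noteq> v \<Longrightarrow> \<exists>b. (a, b) \<in> parcs G \<and> f a = Suc (f b)"
  shows "gdist G u v = f u"
proof -
  interpret pair_wf_digraph G by fact
  have walk: "\<exists>p. awalk a p v \<and> length p = f a" if "a \<in> pverts G" for a
    using that
  proof (induction "f a" arbitrary: a)
    case 0
    then have "a = v" using descent[of a] by auto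
    then show ?case using v zero by (auto simp: awalk_Nil_iff intro!: exI[of _ "[]"])
  next
    case (Suc k)
    then have "a \<noteq> v" using zero by auto
    then obtain b where b: "(a, b) \<in> parcs G" "f a = Suc (f b)"
      using descent Suc.prems by blast
    have "b \<in> pverts G" using b(1) by (rule in_arcsD2)
    then obtain p where "awalk b p v" "length p = f b"
      using Suc.hyps(1)[of b] Suc.hyps(2) b(2) by auto
    then show ?case using b Suc.prems
      by (intro exI[of _ "(a, b) # p"]) (auto simp: awalk_Cons_iff)
  qed
  have lower: "f a \<le> length p" if "awalk a p v" for a p
    using that
  proof (induction p arbitrary: a)
    case Nil
    then show ?case using zero by (auto simp: awalk_Nil_iff)
  next
    case (Cons e p)
    then have e: "e \<in> parcs G" "fst e = a" and p: "awalk (snd e) p v"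
      by (auto simp: awalk_Cons_iff)
    have "f a \<le> Suc (f (snd e))" using lip[of a "snd e"] e by auto
    then show ?case using Cons.IH[OF p] by simp
  qed
  show ?thesis unfolding gdist_def
    by (rule Least_equality) (use walk[OF u] lower in auto)
qed

text \<open>
  The form in which connectedness of a landmark set is used: a part of \<open>S\<close> that no edge inside
  \<open>S\<close> leaves is all of \<open>S\<close>.
\<close>
lemma connected_induced_no_proper_closed:
  assumes "Digraph_Component.connected (with_proj G \<restriction> S)" and sym: "sym (parcs G)"
    and P: "P \<subseteq> S" "p \<in> P"
    and closed: "\<And>u v. u \<in> P \<Longrightarrow> v \<in> S \<Longrightarrow> (u, v) \<in> parcs G \<Longrightarrow> v \<in> P"
  shows "P = S"
proof -
  let ?H = "mk_symmetric (with_proj G \<restriction> S)"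
  have arcs: "parcs ?H = {(u, v) \<in> parcs G. u \<in> S \<and> v \<in> S}"
    using sym by (auto simp: mk_symmetric_def sym_def)
  have "v \<in> P" if v: "v \<in> S" for v
  proof -
    have "p \<rightarrow>\<^sup>*\<^bsub>with_proj ?H\<^esub> v"
      using assms(1) P v unfolding connected_def strongly_connected_def
      by (auto simp: mk_symmetric_def)
    then have "(p, v) \<in> rtrancl_on S (parcs ?H)"
      by (simp add: reachable_def)
    then show ?thesis
      by (induction rule: rtrancl_on_induct) (use P closed arcs in auto)
  qed
  then show ?thesis using P by auto
qed

text \<open>
  From every vertex a descending path inside \<open>S\<close> ends in \<open>w\<close>, the only local minimum.
\<close>
lemma connected_inducedI:
  fixes f :: "'a \<Rightarrow> nat"
  assumes sym: "sym (parcs G)" and w: "w \<in> S"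
    and descent: "\<And>u. u \<in> S \<Longrightarrow> u \<noteq> w \<Longrightarrow> \<exists>v\<in>S. (u, v) \<in> parcs G \<and> f v < f u"
  shows "Digraph_Component.connected (with_proj G \<restriction> S)"
proof -
  let ?H = "mk_symmetric (with_proj G \<restriction> S)"
  have arcs: "parcs ?H = {(u, v) \<in> parcs G. u \<in> S \<and> v \<in> S}"
    and verts: "pverts ?H = S"
    using sym by (auto simp: mk_symmetric_def sym_def)
  interpret pair_wf_digraph ?H
    by unfold_locales (auto simp: arcs verts)
  have to_w: "u \<rightarrow>\<^sup>*\<^bsub>with_proj ?H\<^esub> w" if "u \<in> S" for u
    using that
  proof (induction "f u" arbitrary: u rule: less_induct)
    case less
    show ?case
    proof (cases "u = w")
      case True
      then show ?thesis using w verts by simp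
    next
      case False
      then obtain v where v: "v \<in> S" "(u, v) \<in> parcs G" "f v < f u"
        using descent less.prems by blast
      have "(u, v) \<in> parcs ?H" using v less.prems arcs by simp
      then show ?thesis using less.hyps[OF v(3) v(1)] by (rule adj_reachable_trans)
    qed
  qed
  have symH: "symmetric (with_proj ?H)"
    using sym by (simp add: symmetric_def arcs sym_def)
  have "u \<rightarrow>\<^sup>*\<^bsub>with_proj ?H\<^esub> v" if "u \<in> S" "v \<in> S" for u v
    using to_w[OF that(1)] symmetric_reachable[OF symH to_w[OF that(2)]]
    by (rule reachable_trans)
  then show ?thesis using w
    unfolding connected_def strongly_connected_def by (auto simp: verts)
qed

section \<open>Distance on the integers modulo n\<close>

text \<open>
  The distance from \<open>0\<close> to \<open>a\<close> in the cycle graph on the residues modulo \<open>n\<close>.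
\<close>
definition cdist :: "int \<Rightarrow> int \<Rightarrow> nat" where
  "cdist n a = nat (min (a mod n) (- a mod n))"

lemma cdist_of_residue:
  assumes "0 \<le> a" "a < n"
  shows "cdist n a = nat (min a (n - a))"
  using assms by (cases "a = 0") (auto simp: cdist_def zmod_zminus1_eq_if)

lemma cdist_cong: "n dvd a - b \<Longrightarrow> cdist n a = cdist n b"
  unfolding cdist_def by (metis mod_eq_dvd_iff mod_minus_eq)

lemma cdist_minus [simp]: "cdist n (- a) = cdist n a"
  by (simp add: cdist_def min.commute)

lemma cdist_0 [simp]: "cdist n 0 = 0"
  by (simp add: cdist_def)

lemma cdist_small:
  assumes "0 \<le> a" "2 * a \<le> n"
  shows "cdist n a = nat a"
  using assms by (cases "a = 0") (auto simp: cdist_of_residue)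

text \<open>
  Every residue has a representative of absolute value \<open>cdist n a\<close>. The sign \<open>\<sigma>\<close> records
  the direction of a shortest path from \<open>0\<close> and lets both directions be treated at once.
\<close>
lemma cdist_representative:
  assumes "n > 0"
  obtains \<sigma> :: int where "\<sigma> \<in> {1, - 1}" "n dvd a - \<sigma> * int (cdist n a)"
    "2 * int (cdist n a) \<le> n"
proof -
  define r where "r = a mod n"
  have r: "0 \<le> r" "r < n" "n dvd a - r" using assms by (auto simp: r_def)
  have c: "cdist n a = nat (min r (n - r))"
    using cdist_cong[OF r(3)] cdist_of_residue[OF r(1,2)] by simp
  show ?thesis
  proof (cases "r \<le> n - r")
    case True
    then show ?thesis using that[of 1] r c by auto
  next
    case False
    have "a - - 1 * int (cdist n a) = (a - r) + n" using False r c by auto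
    also have "n dvd \<dots>" using r(3) by simp
    finally show ?thesis using that[of "- 1"] False r c by auto
  qed
qed

lemma cdist_le_half: "n > 0 \<Longrightarrow> 2 * int (cdist n a) \<le> n"
  by (metis cdist_representative)

lemma cdist_eq_0_iff:
  assumes "n > 0"
  shows "cdist n a = 0 \<longleftrightarrow> n dvd a"
proof
  assume "cdist n a = 0"
  then show "n dvd a" using cdist_representative[OF assms, of a] by auto
next
  assume "n dvd a"
  then show "cdist n a = 0" using cdist_cong[of n a 0] by simp
qed

text \<open>
  The circle of a given radius around \<open>0\<close> consists of two opposite residues.
\<close>
lemma cdist_eq_cases:
  assumes "n > 0" "cdist n a = cdist n b"
  shows "n dvd a - b \<or> n dvd a + b"
proof -
  obtain s where s: "s \<in> {1, - 1}" "n dvd a - s * int (cdist n a)"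
    using cdist_representative[OF assms(1)] by metis
  obtain t where t: "t \<in> {1, - 1}" "n dvd b - t * int (cdist n a)"
    using cdist_representative[OF assms(1), of b] assms(2) by metis
  show ?thesis
  proof (cases "s = t")
    case True
    then show ?thesis using dvd_diff[OF s(2) t(2)] by simp
  next
    case False
    then have eq: "(a - s * int (cdist n a)) + (b - t * int (cdist n a)) = a + b" using s t by auto
    show ?thesis using dvd_add[OF s(2) t(2)] unfolding eq ..
  qed
qed

lemma cdist_step:
  assumes "n > 0"
  shows "cdist n (a + 1) \<le> Suc (cdist n a)" "cdist n a \<le> Suc (cdist n (a + 1))"
proof -
  define r where "r = a mod n"
  have r: "0 \<le> r" "r < n" "n dvd a - r" using assms by (auto simp: r_def)
  have c: "cdist n a = nat (min r (n - r))"
    using cdist_cong[OF r(3)] cdist_of_residue[OF r(1,2)] by simp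
  have "n dvd (a + 1) - (r + 1)" using r(3) by simp
  then have c1: "cdist n (a + 1) = cdist n (r + 1)" by (rule cdist_cong)
  have "cdist n (r + 1) \<le> Suc (cdist n a) \<and> cdist n a \<le> Suc (cdist n (r + 1))"
  proof (cases "r + 1 = n")
    case True
    then have "cdist n (r + 1) = 0" using cdist_cong[of n n 0] by simp
    then show ?thesis using c True by auto
  next
    case False
    then have "cdist n (r + 1) = nat (min (r + 1) (n - (r + 1)))"
      using r by (intro cdist_of_residue) auto
    then show ?thesis using c r by auto
  qed
  then show "cdist n (a + 1) \<le> Suc (cdist n a)" "cdist n a \<le> Suc (cdist n (a + 1))"
    using c1 by auto
qed

lemma cdist_descent:
  assumes "n > 0" "\<not> n dvd a"
  shows "\<exists>s\<in>{1, - 1}. cdist n a = Suc (cdist n (a - s))"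
proof -
  obtain s where s: "s \<in> {1, - 1}" "n dvd a - s * int (cdist n a)" "2 * int (cdist n a) \<le> n"
    using cdist_representative[OF assms(1)] by metis
  have pos: "cdist n a > 0" using assms cdist_eq_0_iff by auto
  have "n dvd (a - s) - s * (int (cdist n a) - 1)" using s(2) by (simp add: algebra_simps)
  then have "cdist n (a - s) = cdist n (s * (int (cdist n a) - 1))" by (rule cdist_cong)
  also have "\<dots> = cdist n (int (cdist n a) - 1)"
    using s(1) cdist_minus[of n "int (cdist n a) - 1"] by auto
  also have "\<dots> = cdist n a - 1" using s(3) pos by (subst cdist_small) auto
  finally show ?thesis using s(1) pos by auto
qed

section \<open>Bouquets in coordinates\<close>

text \<open>
  The \<open>j\<close>-th cycle is wound onto the integers: \<open>x j\<close> has period \<open>n j\<close> and starts at \<open>w\<close>.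
  Reversing the orientation of a cycle is then \<open>a \<mapsto> - a\<close>, and distances on the cycle are values
  of \<open>cdist\<close>. A single cycle is the case of a one-element \<open>J\<close>, so it is covered by the same
  distance formula.
\<close>
locale cycle_bouquet =
  fixes B :: "'a pair_pre_digraph" and w :: 'a and J :: "'i set"
    and n :: "'i \<Rightarrow> int" and x :: "'i \<Rightarrow> int \<Rightarrow> 'a"
  assumes finite_J: "finite J"
    and length_ge: "j \<in> J \<Longrightarrow> 3 \<le> n j"
    and x_eq_iff: "j \<in> J \<Longrightarrow> x j a = x j b \<longleftrightarrow> n j dvd a - b"
    and x_0: "j \<in> J \<Longrightarrow> x j 0 = w"
    and x_meet: "j \<in> J \<Longrightarrow> k \<in> J \<Longrightarrow> j \<noteq> k \<Longrightarrow> x j a = x k b \<Longrightarrow> x j a = w"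
    and verts_B: "pverts B = (\<Union>j\<in>J. range (x j))"
    and arcs_B: "parcs B = {(x j a, x j b) | j a b. j \<in> J \<and> (b = a + 1 \<or> a = b + 1)}"
begin

lemma length_pos: "j \<in> J \<Longrightarrow> 0 < n j"
  using length_ge by force

lemma x_eq_w_iff: "j \<in> J \<Longrightarrow> x j a = w \<longleftrightarrow> n j dvd a"
  using x_eq_iff[of j a 0] x_0 by simp

lemma x_in_verts: "j \<in> J \<Longrightarrow> x j a \<in> pverts B"
  by (auto simp: verts_B)

lemma wf_B: "pair_wf_digraph B"
  by unfold_locales (auto simp: arcs_B verts_B, blast+)

lemma sym_B: "sym (parcs B)"
  by (auto simp: arcs_B sym_def)

lemma arc_step: "j \<in> J \<Longrightarrow> s \<in> {1, - 1} \<Longrightarrow> (x j a, x j (a - s)) \<in> parcs B"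
  unfolding arcs_B by force

definition petal :: "'i \<Rightarrow> 'a set" where
  "petal j = range (x j) - {w}"

lemma petal_conv:
  assumes j: "j \<in> J"
  shows "petal j = x j ` {1..<n j}"
proof
  show "petal j \<subseteq> x j ` {1..<n j}"
  proof
    fix u assume "u \<in> petal j"
    then obtain a where a: "u = x j a" "u \<noteq> w" by (auto simp: petal_def)
    have "x j a = x j (a mod n j)" using j by (simp add: x_eq_iff)
    moreover have "a mod n j \<in> {1..<n j}"
      using a x_eq_w_iff[OF j] length_pos[OF j] pos_mod_bound[of "n j" a]
        pos_mod_sign[of "n j" a] by (auto simp: dvd_eq_mod_eq_0 simp del: pos_mod_bound pos_mod_sign)
    ultimately show "u \<in> x j ` {1..<n j}" using a by auto
  qed
  have "x j a \<noteq> w" if "a \<in> {1..<n j}" for a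
    using that x_eq_w_iff[OF j] zdvd_not_zless[of a "n j"] by auto
  then show "x j ` {1..<n j} \<subseteq> petal j"
    unfolding petal_def by (intro image_subsetI) blast
qed

lemma finite_petal: "j \<in> J \<Longrightarrow> finite (petal j)"
  by (simp add: petal_conv)

lemma petals_disjoint: "j \<in> J \<Longrightarrow> k \<in> J \<Longrightarrow> j \<noteq> k \<Longrightarrow> petal j \<inter> petal k = {}"
  using x_meet by (auto simp: petal_def)

lemma verts_eq_petals: "J \<noteq> {} \<Longrightarrow> pverts B = insert w (\<Union>j\<in>J. petal j)"
  using x_0 by (auto simp: verts_B petal_def)

lemma w_notin_petal: "w \<notin> petal j"
  by (simp add: petal_def)

lemma petal_subset_verts: "j \<in> J \<Longrightarrow> petal j \<subseteq> pverts B"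
  by (auto simp: petal_def verts_B)

text \<open>
  A vertex of a petal has only its two neighbours on the cycle, as cycles meet nowhere but in \<open>w\<close>.
\<close>
lemma arc_from_petal:
  assumes j: "j \<in> J" and "x j a \<noteq> w" and arc: "(x j a, v) \<in> parcs B"
  obtains "v = x j (a + 1)" | "v = x j (a - 1)"
proof -
  obtain k c d where k: "k \<in> J" "x j a = x k c" "v = x k d" "d = c + 1 \<or> c = d + 1"
    using arc unfolding arcs_B by blast
  then have "k = j" using x_meet[OF j k(1)] assms(2) by blast
  have dv: "n j dvd a - c" using k \<open>k = j\<close> x_eq_iff[OF j] by simp
  from k(4) show ?thesis
  proof
    assume "d = c + 1"
    then have "v = x j (a + 1)" using dv k(3) \<open>k = j\<close> x_eq_iff[OF j] by (simp add: dvd_diff_commute)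
    then show ?thesis by (rule that)
  next
    assume "c = d + 1"
    then have "d - (a - 1) = - (a - c)" by simp
    then have "v = x j (a - 1)" using dv k(3) \<open>k = j\<close> x_eq_iff[OF j] by (metis dvd_minus_iff)
    then show ?thesis by (rule that)
  qed
qed

text \<open>
  The distance to \<open>x j b\<close> as a function on vertices. Coordinates are unique only up to the period,
  and \<open>w\<close> lies on all cycles; the formulas agree there because \<open>cdist\<close> is periodic and vanishes
  at \<open>0\<close>.
\<close>
lemma ex_distance_function:
  assumes j: "j \<in> J"
  shows "\<exists>f. (\<forall>a. f (x j a) = cdist (n j) (a - b)) \<and>
    (\<forall>k\<in>J - {j}. \<forall>a. f (x k a) = cdist (n k) a + cdist (n j) b)"
proof -
  define pos where "pos k u = (SOME a. x k a = u)" for k u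
  have pos: "n k dvd pos k (x k a) - a" if "k \<in> J" for k a
  proof -
    have "x k (pos k (x k a)) = x k a" unfolding pos_def by (rule someI) simp
    then show ?thesis using x_eq_iff[OF that] by simp
  qed
  define petal_of where "petal_of u = (SOME k. k \<in> J \<and> u \<in> range (x k))" for u
  define f where "f u = (if u \<in> range (x j) then cdist (n j) (pos j u - b)
    else cdist (n (petal_of u)) (pos (petal_of u) u) + cdist (n j) b)" for u
  have same: "f (x j a) = cdist (n j) (a - b)" for a
  proof -
    have "(pos j (x j a) - b) - (a - b) = pos j (x j a) - a" by simp
    then show ?thesis using pos[OF j, of a] unfolding f_def by (auto intro!: cdist_cong)
  qed
  moreover have "f (x k a) = cdist (n k) a + cdist (n j) b" if k: "k \<in> J" "k \<noteq> j" for k a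
  proof (cases "x k a = w")
    case True
    then have "f (x k a) = cdist (n j) (0 - b)" using same[of 0] x_0[OF j] by simp
    moreover have "cdist (n k) a = 0"
      using True x_eq_w_iff[OF k(1)] cdist_eq_0_iff[OF length_pos[OF k(1)]] by simp
    ultimately show ?thesis by simp
  next
    case False
    have "petal_of (x k a) \<in> J \<and> x k a \<in> range (x (petal_of (x k a)))"
      unfolding petal_of_def by (rule someI[of _ k]) (use k in auto)
    then have "petal_of (x k a) = k" using x_meet[OF k(1)] False by (metis imageE)
    moreover have "x k a \<notin> range (x j)" using x_meet[OF k(1) j k(2)] False by auto
    ultimately show ?thesis using cdist_cong[OF pos[OF k(1)]] by (simp add: f_def)
  qed
  ultimately show ?thesis by auto
qed

lemma gdist_same_and_cross:
  assumes j: "j \<in> J"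
  shows "gdist B (x j a) (x j b) = cdist (n j) (a - b)"
    and "k \<in> J \<Longrightarrow> k \<noteq> j \<Longrightarrow> gdist B (x k a) (x j b) = cdist (n k) a + cdist (n j) b"
proof -
  obtain f where same: "\<And>a. f (x j a) = cdist (n j) (a - b)"
    and cross: "\<And>k a. k \<in> J \<Longrightarrow> k \<noteq> j \<Longrightarrow> f (x k a) = cdist (n k) a + cdist (n j) b"
    using ex_distance_function[OF j, of b] by blast
  have dist: "gdist B u (x j b) = f u" if u: "u \<in> pverts B" for u
  proof (rule gdist_eqI[OF wf_B x_in_verts[OF j] u])
    show "f (x j b) = 0" by (simp add: same)
  next
    fix p q assume "(p, q) \<in> parcs B"
    then obtain k c d where k: "k \<in> J" "p = x k c" "q = x k d" "d = c + 1 \<or> c = d + 1"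
      unfolding arcs_B by blast
    show "f p \<le> Suc (f q)"
    proof (cases "k = j")
      case True
      have "c - b = (d - b) + 1 \<or> d - b = (c - b) + 1" using k(4) by auto
      then show ?thesis using k True same cdist_step[OF length_pos[OF j]] by metis
    next
      case False
      then show ?thesis using k cross[OF k(1)] cdist_step[OF length_pos[OF k(1)]]
        by (metis add_Suc add_le_mono1)
    qed
  next
    fix p assume p: "p \<in> pverts B" "p \<noteq> x j b"
    show "\<exists>q. (p, q) \<in> parcs B \<and> f p = Suc (f q)"
    proof (cases "p \<in> range (x j)")
      case True
      then obtain c where c: "p = x j c" by auto
      then have "\<not> n j dvd c - b" using p x_eq_iff[OF j] by simp
      from cdist_descent[OF length_pos[OF j] this] obtain s
        where s: "s \<in> {1, - 1}" "cdist (n j) (c - b) = Suc (cdist (n j) (c - b - s))" by blast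
      have "f (x j (c - s)) = cdist (n j) (c - b - s)" by (simp add: same algebra_simps)
      then show ?thesis using s c same arc_step[OF j s(1)] by metis
    next
      case False
      then obtain k c where k: "k \<in> J" "k \<noteq> j" "p = x k c" using p by (auto simp: verts_B)
      have "p \<noteq> w" using False x_0[OF j] by auto
      then have "\<not> n k dvd c" using k x_eq_w_iff[OF k(1)] by simp
      from cdist_descent[OF length_pos[OF k(1)] this] obtain s
        where s: "s \<in> {1, - 1}" "cdist (n k) c = Suc (cdist (n k) (c - s))" by blast
      then show ?thesis using k cross[OF k(1,2)] arc_step[OF k(1) s(1)] by (metis add_Suc)
    qed
  qed
  show "gdist B (x j a) (x j b) = cdist (n j) (a - b)"
    using dist[OF x_in_verts[OF j]] same by simp
  show "gdist B (x k a) (x j b) = cdist (n k) a + cdist (n j) b" if "k \<in> J" "k \<noteq> j"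
    using dist[OF x_in_verts[OF that(1)]] cross[OF that] by simp
qed

lemmas gdist_same = gdist_same_and_cross(1)

lemma gdist_w: "j \<in> J \<Longrightarrow> gdist B (x j a) w = cdist (n j) a"
  using gdist_same[of j a 0] by (simp add: x_0)

lemma gdist_from_w: "j \<in> J \<Longrightarrow> gdist B w (x j a) = cdist (n j) a"
  using gdist_same[of j 0 a] by (simp add: x_0)

text \<open>
  The vertex \<open>w\<close> separates a petal from the rest of the bouquet.
\<close>
lemma gdist_through_w:
  assumes j: "j \<in> J" and u: "u \<in> petal j" and z: "z \<in> pverts B" "z \<notin> petal j"
  shows "gdist B u z = gdist B u w + gdist B w z"
proof -
  obtain a where a: "u = x j a" using u by (auto simp: petal_def)
  obtain k c where k: "k \<in> J" "z = x k c" using z by (auto simp: verts_B)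
  show ?thesis
  proof (cases "k = j")
    case True
    then have "z = w" using k z by (auto simp: petal_def)
    then show ?thesis using gdist_from_w[OF j, of 0] j by (simp add: x_0)
  next
    case False
    then show ?thesis
      using gdist_same_and_cross(2)[OF k(1) j] a k gdist_w[OF j] gdist_from_w[OF k(1)] by simp
  qed
qed

lemma petal_coordinate:
  assumes j: "j \<in> J" and v: "v \<in> petal j"
  obtains \<sigma> :: int and d :: nat where "\<sigma> \<in> {1, - 1}" "v = x j (\<sigma> * int d)"
    "d = gdist B v w" "0 < d" "2 * int d \<le> n j"
proof -
  obtain a where a: "v = x j a" "v \<noteq> w" using v by (auto simp: petal_def)
  have d: "cdist (n j) a = gdist B v w" using gdist_w[OF j] a by simp
  obtain s where s: "s \<in> {1, - 1}" "n j dvd a - s * int (cdist (n j) a)"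
    "2 * int (cdist (n j) a) \<le> n j"
    using cdist_representative[OF length_pos[OF j]] by metis
  have "cdist (n j) a > 0"
    using a x_eq_w_iff[OF j] cdist_eq_0_iff[OF length_pos[OF j]] by auto
  then show ?thesis using s a d x_eq_iff[OF j] that by metis
qed

lemma gdist_arc:
  assumes j: "j \<in> J" and \<sigma>: "\<sigma> \<in> {1, - 1}"
  shows "gdist B (x j (\<sigma> * a)) (x j (\<sigma> * b)) = cdist (n j) (a - b)"
  using \<sigma> gdist_same[OF j] cdist_minus[of "n j" "a - b"] by auto

lemma gdist_arc_w:
  assumes "j \<in> J" "\<sigma> \<in> {1, - 1}" "0 \<le> t" "2 * t \<le> n j"
  shows "gdist B (x j (\<sigma> * t)) w = nat t" "gdist B w (x j (\<sigma> * t)) = nat t"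
proof -
  have "cdist (n j) (\<sigma> * t) = nat t"
    using assms(2) cdist_small[OF assms(3,4)] cdist_minus[of "n j" t] by auto
  then show "gdist B (x j (\<sigma> * t)) w = nat t" "gdist B w (x j (\<sigma> * t)) = nat t"
    using gdist_w[OF assms(1)] gdist_from_w[OF assms(1)] by simp_all
qed

lemma gdist_le_half:
  assumes j: "j \<in> J" and "u \<in> range (x j)" "z \<in> range (x j)"
  shows "2 * int (gdist B u z) \<le> n j"
  using assms cdist_le_half[OF length_pos[OF j]] by (auto simp: gdist_same)

section \<open>Lower bounds: arcs and blind petals\<close>

lemma connected_resolving_subset: "connected_resolving_set B S \<Longrightarrow> S \<subseteq> pverts B"
  by (simp add: connected_resolving_set_def resolving_set_def)

lemma neighbour_in_petal:
  assumes "j \<in> J" "s \<in> {1, - 1}"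
  shows "x j s \<in> petal j" "gdist B (x j s) w = 1"
proof -
  have "cdist (n j) s = cdist (n j) 1" using assms(2) cdist_minus[of "n j" 1] by auto
  also have "\<dots> = 1" using length_ge[OF assms(1)] by (subst cdist_small) auto
  finally have c: "cdist (n j) s = 1" .
  show "gdist B (x j s) w = 1" using c gdist_w[OF assms(1)] by simp
  have "\<not> n j dvd s" using c cdist_eq_0_iff[OF length_pos[OF assms(1)], of s] by simp
  then show "x j s \<in> petal j" using x_eq_w_iff[OF assms(1)] by (auto simp: petal_def)
qed

text \<open>
  The landmarks in \<open>Z\<close> see of \<open>u\<close> no more than its distance from \<open>w\<close>.
\<close>
definition blind_at :: "'a set \<Rightarrow> 'a \<Rightarrow> bool" where
  "blind_at Z u \<longleftrightarrow> (\<forall>z\<in>Z. gdist B u z = gdist B u w + gdist B w z)"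

lemma unresolved_blind_pair:
  assumes jk: "j \<in> J" "k \<in> J" "j \<noteq> k" and u: "u \<in> petal j" "u' \<in> petal k"
    and S: "S \<subseteq> pverts B" and eq: "gdist B u w = gdist B u' w"
    and blind: "blind_at (S \<inter> petal j) u" "blind_at (S \<inter> petal k) u'" and z: "z \<in> S"
  shows "gdist B u z = gdist B u' z"
proof -
  have "gdist B u z = gdist B u w + gdist B w z"
    using blind(1) z S gdist_through_w[OF jk(1) u(1), of z] by (cases "z \<in> petal j") (auto simp: blind_at_def)
  moreover have "gdist B u' z = gdist B u' w + gdist B w z"
    using blind(2) z S gdist_through_w[OF jk(2) u(2), of z] by (cases "z \<in> petal k") (auto simp: blind_at_def)
  ultimately show ?thesis using eq by simp
qed

text \<open>
  Only neighbours of \<open>w\<close> are considered, so that blind vertices in two different petals are at the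
  same distance from \<open>w\<close>.
\<close>
definition blind_petal :: "'a set \<Rightarrow> 'i \<Rightarrow> bool" where
  "blind_petal S j \<longleftrightarrow> (\<exists>s\<in>{1, - 1}. blind_at (S \<inter> petal j) (x j s))"

lemma blind_petal_unique:
  assumes S: "connected_resolving_set B S" and j: "j \<in> J" "blind_petal S j"
    and k: "k \<in> J" "blind_petal S k"
  shows "j = k"
proof (rule ccontr)
  assume "j \<noteq> k"
  from j obtain s where s: "s \<in> {1, - 1}" "blind_at (S \<inter> petal j) (x j s)"
    unfolding blind_petal_def by blast
  from k obtain t where t: "t \<in> {1, - 1}" "blind_at (S \<inter> petal k) (x k t)"
    unfolding blind_petal_def by blast
  note u = neighbour_in_petal[OF j(1) s(1)] neighbour_in_petal[OF k(1) t(1)]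
  have "x j s \<noteq> x k t" using petals_disjoint[OF j(1) k(1) \<open>j \<noteq> k\<close>] u by auto
  moreover have "gdist B (x j s) z = gdist B (x k t) z" if "z \<in> S" for z
    using unresolved_blind_pair[OF j(1) k(1) \<open>j \<noteq> k\<close> u(1,3) connected_resolving_subset[OF S] _ s(2) t(2) that] u
    by simp
  ultimately show False
    using S x_in_verts[OF j(1)] x_in_verts[OF k(1)]
    unfolding connected_resolving_set_def resolving_set_def by blast
qed

text \<open>
  Otherwise the two neighbours of \<open>w\<close> on the \<open>j\<close>-th cycle have equal distances to all of \<open>S\<close>.
\<close>
lemma meets_petal:
  assumes S: "connected_resolving_set B S" and j: "j \<in> J"
  shows "S \<inter> petal j \<noteq> {}"
proof
  assume empty: "S \<inter> petal j = {}"
  have one: "1 \<in> {1, - 1 :: int}" and mone: "- 1 \<in> {1, - 1 :: int}" by auto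
  note u = neighbour_in_petal[OF j one] neighbour_in_petal[OF j mone]
  have "gdist B (x j 1) z = gdist B (x j (- 1)) z" if "z \<in> S" for z
  proof -
    have z: "z \<in> pverts B" "z \<notin> petal j" using that empty connected_resolving_subset[OF S] by auto
    show ?thesis
      using gdist_through_w[OF j u(1) z] gdist_through_w[OF j u(3) z] u(2,4) by simp
  qed
  moreover have "x j 1 \<noteq> x j (- 1)"
    using x_eq_iff[OF j, of 1 "- 1"] length_ge[OF j] zdvd_not_zless[of 2 "n j"] by auto
  ultimately show False
    using S x_in_verts[OF j] unfolding connected_resolving_set_def resolving_set_def by blast
qed

text \<open>
  The set meets two petals, and every edge that leaves a petal ends in \<open>w\<close>.
\<close>
lemma w_in_connected_resolving:
  assumes S: "connected_resolving_set B S" and two: "i \<in> J" "k \<in> J" "i \<noteq> k"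
  shows "w \<in> S"
proof (rule ccontr)
  assume w: "w \<notin> S"
  obtain p where p: "p \<in> S \<inter> petal i" using meets_petal[OF S two(1)] by auto
  have "S \<inter> petal i = S"
  proof (rule connected_induced_no_proper_closed[OF _ sym_B _ p])
    show "Digraph_Component.connected (with_proj B \<restriction> S)"
      using S by (simp add: connected_resolving_set_def)
    fix u v assume uv: "u \<in> S \<inter> petal i" "v \<in> S" "(u, v) \<in> parcs B"
    then obtain a where a: "u = x i a" "x i a \<noteq> w" by (auto simp: petal_def)
    have "v \<in> range (x i)" using arc_from_petal[OF two(1) a(2)] uv(3) a(1) by blast
    then show "v \<in> S \<inter> petal i" using uv(2) w by (auto simp: petal_def)
  qed simp
  then show False using meets_petal[OF S two(2)] petals_disjoint[OF two] by blast
qed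

text \<open>
  The path of \<open>d\<close> vertices that starts next to \<open>w\<close> and runs in direction \<open>\<sigma>\<close>.
\<close>
definition arc_from_w :: "'i \<Rightarrow> int \<Rightarrow> nat \<Rightarrow> 'a set" where
  "arc_from_w j \<sigma> d = (\<lambda>t. x j (\<sigma> * t)) ` {1..int d}"

lemma card_arc_from_w:
  assumes j: "j \<in> J" and \<sigma>: "\<sigma> \<in> {1, - 1}" and d: "2 * int d \<le> n j"
  shows "card (arc_from_w j \<sigma> d) = d"
proof -
  have "inj_on (\<lambda>t. x j (\<sigma> * t)) {1..int d}"
  proof (rule inj_onI)
    fix s t assume st: "s \<in> {1..int d}" "t \<in> {1..int d}" "x j (\<sigma> * s) = x j (\<sigma> * t)"
    then have "n j dvd \<sigma> * (s - t)" using x_eq_iff[OF j] by (simp add: right_diff_distrib)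
    then have "n j dvd s - t" using \<sigma> dvd_minus_iff[of "n j" "s - t"] by auto
    then have "s mod n j = t mod n j" by (simp add: mod_eq_dvd_iff)
    then show "s = t" using st d length_pos[OF j] by simp
  qed
  then show ?thesis by (simp add: arc_from_w_def card_image)
qed

text \<open>
  If both arcs between \<open>w\<close> and \<open>v\<close> had a gap, the gaps would cut off the part of \<open>S\<close> around
  \<open>v\<close> from \<open>w\<close>. The arc in \<open>S\<close> may be the longer one; its first \<open>d(v,w)\<close> vertices, which form
  an arc from \<open>w\<close> but need not reach \<open>v\<close>, are all that the counting uses.
\<close>
lemma contains_arc:
  assumes S: "connected_resolving_set B S" and w: "w \<in> S" and j: "j \<in> J" and v: "v \<in> S \<inter> petal j"
  obtains \<sigma> :: int where "\<sigma> \<in> {1, - 1}"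
    "arc_from_w j \<sigma> (gdist B v w) \<subseteq> S \<inter> petal j"
proof -
  obtain a where a: "v = x j a" "1 \<le> a" "a < n j" using v petal_conv[OF j] by auto
  have d: "gdist B v w = nat (min a (n j - a))"
    using gdist_w[OF j] cdist_of_residue[of a "n j"] a by simp
  have petal: "x j t \<in> petal j" if "1 \<le> t" "t < n j" for t
    using that petal_conv[OF j] by auto
  have "x j ` {1..a} \<subseteq> S \<or> x j ` {a..<n j} \<subseteq> S"
  proof (rule ccontr)
    assume "\<not> ?thesis"
    then have not_sub: "\<not> x j ` {1..a} \<subseteq> S" "\<not> x j ` {a..<n j} \<subseteq> S" by simp_all
    from not_sub(1) obtain e where e: "1 \<le> e" "e \<le> a" "x j e \<notin> S"
      by (metis atLeastAtMost_iff image_subsetI)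
    from not_sub(2) obtain f where f: "a \<le> f" "f < n j" "x j f \<notin> S"
      by (metis atLeastLessThan_iff image_subsetI)
    have "e \<noteq> a" "f \<noteq> a" using e f v a by auto
    define P where "P = S \<inter> x j ` {e<..<f}"
    have vP: "v \<in> P" unfolding P_def using v a e f \<open>e \<noteq> a\<close> \<open>f \<noteq> a\<close> by auto
    have "P = S"
    proof (rule connected_induced_no_proper_closed[OF _ sym_B _ vP])
      show "Digraph_Component.connected (with_proj B \<restriction> S)"
        using S by (simp add: connected_resolving_set_def)
      show "P \<subseteq> S" by (auto simp: P_def)
      fix u u' assume u: "u \<in> P" "u' \<in> S" "(u, u') \<in> parcs B"
      then obtain t where t: "u = x j t" "e < t" "t < f" by (auto simp: P_def)
      have "x j t \<noteq> w" using petal[of t] t e f by (auto simp: petal_def)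
      then consider "u' = x j (t + 1)" | "u' = x j (t - 1)"
        using arc_from_petal[OF j] u(3) t(1) by blast
      then show "u' \<in> P"
      proof cases
        case 1
        then have "t + 1 \<noteq> f" using u(2) f by auto
        then show ?thesis using 1 t u(2) by (auto simp: P_def)
      next
        case 2
        then have "t - 1 \<noteq> e" using u(2) e by auto
        then show ?thesis using 2 t u(2) by (auto simp: P_def)
      qed
    qed
    then have "w \<in> P" using w by simp
    then obtain t where "w = x j t" "e < t" "t < f" by (auto simp: P_def)
    then show False using petal[of t] e f w_notin_petal[of j] by auto
  qed
  then show ?thesis
  proof
    assume "x j ` {1..a} \<subseteq> S"
    moreover have "int (gdist B v w) \<le> a" using d a by auto
    ultimately show ?thesis using a petal by (intro that[of 1]) (auto simp: arc_from_w_def)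
  next
    assume sub: "x j ` {a..<n j} \<subseteq> S"
    have "x j (- 1 * t) \<in> S \<inter> petal j" if t: "t \<in> {1..int (gdist B v w)}" for t
    proof -
      have "x j (- 1 * t) = x j (n j - t)" using x_eq_iff[OF j] by simp
      moreover have "a \<le> n j - t" "1 \<le> n j - t" "n j - t < n j" using t d a by auto
      ultimately show ?thesis using sub petal[of "n j - t"] by auto
    qed
    then show ?thesis by (intro that[of "- 1"]) (auto simp: arc_from_w_def)
  qed
qed

lemma gdist_le_card:
  assumes S: "connected_resolving_set B S" and w: "w \<in> S" and j: "j \<in> J" and v: "v \<in> S \<inter> petal j"
  shows "gdist B v w \<le> card (S \<inter> petal j)"
proof -
  obtain s where s: "s \<in> {1, - 1}"
    "arc_from_w j s (gdist B v w) \<subseteq> S \<inter> petal j"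
    using contains_arc[OF S w j v] by blast
  have "2 * int (gdist B v w) \<le> n j" using petal_coordinate[OF j] v by (metis IntD2)
  then show ?thesis
    using card_mono[OF _ s(2)] card_arc_from_w[OF j s(1)] finite_petal[OF j] by simp
qed

text \<open>
  By counting, \<open>S\<close> meets the petal in exactly one arc from \<open>w\<close>. As the arc stays short of the far
  side of the cycle, the neighbour of \<open>w\<close> on the opposite side is still nearest to it through \<open>w\<close>.
\<close>
lemma tight_petal_blind:
  assumes S: "connected_resolving_set B S" and w: "w \<in> S" and j: "j \<in> J" and v: "v \<in> S \<inter> petal j"
    and tight: "card (S \<inter> petal j) = gdist B v w" and short: "int (gdist B v w) < n j div 2"
  shows "blind_petal S j"
proof -
  obtain s where s: "s \<in> {1, - 1}"
    "arc_from_w j s (gdist B v w) \<subseteq> S \<inter> petal j"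
    using contains_arc[OF S w j v] by blast
  have "2 * int (gdist B v w) \<le> n j" using short by linarith
  then have "arc_from_w j s (gdist B v w) = S \<inter> petal j"
    using card_arc_from_w[OF j s(1)] tight finite_petal[OF j] s(2) by (intro card_subset_eq) auto
  moreover have "gdist B (x j (- s)) (x j (s * t)) = gdist B (x j (- s)) w + gdist B w (x j (s * t))"
    if t: "t \<in> {1..int (gdist B v w)}" for t
  proof -
    have "gdist B (x j (- s)) (x j (s * t)) = cdist (n j) (- 1 - t)"
      using gdist_arc[OF j s(1), of "- 1" t] by simp
    also have "\<dots> = cdist (n j) (t + 1)" using cdist_minus[of "n j" "t + 1"] by (simp add: algebra_simps)
    also have "\<dots> = nat (t + 1)" using t short by (intro cdist_small) auto
    finally have "gdist B (x j (- s)) (x j (s * t)) = Suc (nat t)" using t by auto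
    moreover have "gdist B w (x j (s * t)) = nat t"
      using t short by (intro gdist_arc_w(2)[OF j s(1)]) auto
    moreover have "gdist B (x j (- s)) w = 1" using s(1) neighbour_in_petal(2)[OF j, of "- s"] by auto
    ultimately show ?thesis by simp
  qed
  ultimately have "blind_at (S \<inter> petal j) (x j (- s))"
    unfolding blind_at_def arc_from_w_def by force
  then show ?thesis using s(1) unfolding blind_petal_def by auto
qed

text \<open>
  The least number of landmarks in a petal that leaves no vertex of it blind, among sets of
  landmarks that are connected together with \<open>w\<close>.
\<close>
definition quota :: "'i \<Rightarrow> nat" where
  "quota j = (if n j = 3 then 1 else 2)"

text \<open>
  A single landmark in the petal is a neighbour of \<open>w\<close>, which leaves a cycle of length at least
  four blind by \<open>tight_petal_blind\<close>.
\<close>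
lemma quota_le:
  assumes S: "connected_resolving_set B S" and w: "w \<in> S" and j: "j \<in> J"
  shows "quota j \<le> card (S \<inter> petal j) + of_bool (blind_petal S j)"
proof -
  obtain v where v: "v \<in> S \<inter> petal j" using meets_petal[OF S j] by auto
  have pos: "0 < gdist B v w" using petal_coordinate[OF j] v by (metis IntD2)
  have le: "gdist B v w \<le> card (S \<inter> petal j)" by (rule gdist_le_card[OF S w j v])
  show ?thesis
  proof (cases "card (S \<inter> petal j) = 1 \<and> n j \<noteq> 3")
    case True
    then have "int (gdist B v w) < n j div 2" using pos le length_ge[OF j] by auto
    moreover have "card (S \<inter> petal j) = gdist B v w" using True pos le by auto
    ultimately have "blind_petal S j" by (intro tight_petal_blind[OF S w j v])
    then show ?thesis using True by (simp add: quota_def)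
  next
    case False
    then show ?thesis using pos le by (auto simp: quota_def)
  qed
qed

lemma card_connected_resolving:
  assumes "connected_resolving_set B S" "w \<in> S"
  shows "card S = Suc (\<Sum>j\<in>J. card (S \<inter> petal j))"
proof -
  have "J \<noteq> {}" using assms connected_resolving_subset by (auto simp: verts_B)
  then have "S = insert w (\<Union>j\<in>J. S \<inter> petal j)"
    using assms(2) connected_resolving_subset[OF assms(1)] by (auto simp: verts_eq_petals)
  moreover have "w \<notin> (\<Union>j\<in>J. S \<inter> petal j)" using w_notin_petal by auto
  moreover have "finite (\<Union>j\<in>J. S \<inter> petal j)" using finite_J finite_petal by auto
  moreover have "card (\<Union>j\<in>J. S \<inter> petal j) = (\<Sum>j\<in>J. card (S \<inter> petal j))"
    using finite_J finite_petal petals_disjoint by (intro card_UN_disjoint) blast+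
  ultimately show ?thesis by (metis card_insert_disjoint)
qed

lemma sum_quota_le:
  assumes S: "connected_resolving_set B S" and w: "w \<in> S" and I: "I \<subseteq> J"
  shows "(\<Sum>j\<in>I. quota j) \<le> (\<Sum>j\<in>I. card (S \<inter> petal j)) + card {j \<in> I. blind_petal S j}"
proof -
  have fin: "finite I" using I finite_J by (rule finite_subset)
  have "(\<Sum>j\<in>I. quota j) \<le> (\<Sum>j\<in>I. card (S \<inter> petal j) + of_bool (blind_petal S j))"
    by (rule sum_mono, rule quota_le[OF S w]) (use I in auto)
  also have "\<dots> = (\<Sum>j\<in>I. card (S \<inter> petal j)) + card {j \<in> I. blind_petal S j}"
    using fin by (simp add: sum.distrib Int_def)
  finally show ?thesis .
qed

text \<open>
  The least size of a connected resolving set through a vertex of the \<open>i\<close>-th petal at distance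
  \<open>d > 0\<close> from \<open>w\<close>. The last summand would be the constant \<open>1\<close> for \<open>w\<close>, were it not that one
  petal may fall short of its quota: a further long cycle can do so if the arc of length \<open>d\<close>
  reaches the far side of its own cycle, so that the \<open>i\<close>-th petal is not blind already.
\<close>
definition cdim_through :: "'i \<Rightarrow> nat \<Rightarrow> nat" where
  "cdim_through i d = d + (\<Sum>j\<in>J - {i}. quota j) +
    (if int d = n i div 2 \<and> (\<exists>e\<in>J - {i}. n e \<noteq> 3) then 0 else 1)"

text \<open>
  The \<open>i\<close>-th petal holds at least \<open>d(v,w)\<close> landmarks, and at most one petal misses its quota. If the
  \<open>i\<close>-th petal holds exactly \<open>d(v,w)\<close> of them on an arc short of the far side, then it is
  the blind one, and the others meet their quotas in full.
\<close>
lemma card_ge_cdim_through: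
  assumes S: "connected_resolving_set B S" and w: "w \<in> S" and i: "i \<in> J" and v: "v \<in> S \<inter> petal i"
  shows "cdim_through i (gdist B v w) \<le> card S"
proof -
  let ?s = "\<lambda>j. card (S \<inter> petal j)" and ?d = "gdist B v w"
  have card: "card S = Suc (?s i + (\<Sum>j\<in>J - {i}. ?s j))"
    using card_connected_resolving[OF S w] i finite_J by (simp add: sum.remove)
  have d: "?d \<le> ?s i" by (rule gdist_le_card[OF S w i v])
  let ?W = "{j \<in> J - {i}. blind_petal S j}"
  have sum: "(\<Sum>j\<in>J - {i}. quota j) \<le> (\<Sum>j\<in>J - {i}. ?s j) + card ?W"
    by (rule sum_quota_le[OF S w]) auto
  have W: "card ?W \<le> 1"
    using blind_petal_unique[OF S] finite_J by (auto simp: card_le_Suc0_iff_eq)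
  have "v \<in> range (x i)" "w \<in> range (x i)"
    using v rangeI[of "x i" 0] x_0[OF i] by (auto simp: petal_def)
  then have "int ?d \<le> n i div 2" using gdist_le_half[OF i, of v w] by auto
  then consider (antipodal) "int ?d = n i div 2" "\<exists>e\<in>J - {i}. n e \<noteq> 3"
    | (triangles) "\<forall>e\<in>J - {i}. n e = 3"
    | (loose) "?d < ?s i"
    | (tight) "int ?d < n i div 2" "?s i = ?d"
    using d by fastforce
  then show ?thesis
  proof cases
    case antipodal
    then show ?thesis using card d sum W by (simp add: cdim_through_def)
  next
    case triangles
    have "(\<Sum>j\<in>J - {i}. quota j) \<le> (\<Sum>j\<in>J - {i}. ?s j)"
    proof (rule sum_mono)
      fix j assume j: "j \<in> J - {i}"
      then have "?s j \<noteq> 0" using meets_petal[OF S] finite_petal by auto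
      then show "quota j \<le> ?s j" using triangles j by (simp add: quota_def)
    qed
    then show ?thesis using triangles card d by (simp add: cdim_through_def)
  next
    case loose
    then show ?thesis using card sum W by (simp add: cdim_through_def)
  next
    case tight
    have "blind_petal S i" by (rule tight_petal_blind[OF S w i v]) (use tight in auto)
    then have "?W = {}" using blind_petal_unique[OF S i] by auto
    then have "(\<Sum>j\<in>J - {i}. quota j) \<le> (\<Sum>j\<in>J - {i}. ?s j)"
      using sum by (simp only: card.empty)
    then show ?thesis using card tight by (simp add: cdim_through_def)
  qed
qed

section \<open>Construction of connected resolving sets\<close>

text \<open>
  Equal distances to \<open>0\<close> and to \<open>s\<close> mean that \<open>a\<close> and \<open>b\<close> agree or are mirror images under both
  reflections. The two reflections differ by a rotation by \<open>2 * s\<close>, which is not trivial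
  modulo \<open>n j \<ge> 3\<close>.
\<close>
lemma eq_if_equidistant:
  assumes j: "j \<in> J" and s: "s \<in> {1, - 1}"
    and w: "gdist B (x j a) w = gdist B (x j b) w"
    and nb: "gdist B (x j a) (x j s) = gdist B (x j b) (x j s)"
  shows "x j a = x j b"
proof (rule ccontr)
  assume "x j a \<noteq> x j b"
  then have ab: "\<not> n j dvd a - b" using x_eq_iff[OF j] by simp
  have "cdist (n j) a = cdist (n j) b" using w gdist_w[OF j] by simp
  then have "n j dvd a + b" using cdist_eq_cases[OF length_pos[OF j]] ab by blast
  moreover have "cdist (n j) (a - s) = cdist (n j) (b - s)" using nb gdist_same[OF j] by simp
  then have "n j dvd (a - s) + (b - s)"
    using cdist_eq_cases[OF length_pos[OF j], of "a - s" "b - s"] ab by auto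
  ultimately have "n j dvd (a + b) - ((a - s) + (b - s))" by (rule dvd_diff)
  then have "n j dvd 2 * s" by simp
  then have "n j dvd 2" using s by auto
  then show False using length_ge[OF j] zdvd_not_zless[of 2 "n j"] by auto
qed

text \<open>
  Vertices on a common cycle are separated by \<open>w\<close> and a neighbour of it. An unresolved pair on
  different cycles consists of two blind vertices: a landmark in the petal of one of them is seen
  by the other one through \<open>w\<close>, hence by both.
\<close>
lemma connected_resolvingI:
  assumes "J \<noteq> {}"
    and sub: "\<And>j. j \<in> J \<Longrightarrow> A j \<subseteq> petal j"
    and descent: "\<And>j u. j \<in> J \<Longrightarrow> u \<in> A j \<Longrightarrow>
      \<exists>v\<in>insert w (A j). (u, v) \<in> parcs B \<and> gdist B v w < gdist B u w"
    and nbr: "\<And>j. j \<in> J \<Longrightarrow> \<exists>s\<in>{1, - 1}. x j s \<in> A j"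
    and sighted: "\<And>j k u u'. j \<in> J \<Longrightarrow> k \<in> J \<Longrightarrow> j \<noteq> k \<Longrightarrow> u \<in> petal j \<Longrightarrow> u' \<in> petal k \<Longrightarrow>
      blind_at (A j) u \<Longrightarrow> blind_at (A k) u' \<Longrightarrow> False"
  shows "connected_resolving_set B (insert w (\<Union>j\<in>J. A j))"
proof -
  let ?S = "insert w (\<Union>j\<in>J. A j)"
  have verts: "?S \<subseteq> pverts B"
    using sub assms(1) by (auto simp: verts_eq_petals)
  have resolved: "p = q"
    if p: "p \<in> pverts B" and q: "q \<in> pverts B" and eq: "\<And>z. z \<in> ?S \<Longrightarrow> gdist B p z = gdist B q z" for p q
  proof (cases "\<exists>j\<in>J. p \<in> range (x j) \<and> q \<in> range (x j)")
    case True
    then obtain j a b where j: "j \<in> J" "p = x j a" "q = x j b" by blast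
    obtain s where s: "s \<in> {1, - 1}" "x j s \<in> A j" using nbr[OF j(1)] by blast
    have "gdist B p w = gdist B q w" "gdist B p (x j s) = gdist B q (x j s)"
      using eq s(2) j(1) by blast+
    then show ?thesis using eq_if_equidistant[OF j(1) s(1)] j(2,3) by blast
  next
    case False
    obtain j k where jk: "j \<in> J" "p \<in> range (x j)" "k \<in> J" "q \<in> range (x k)"
      using p q by (auto simp: verts_B)
    have w: "w \<in> range (x l)" if "l \<in> J" for l using x_0[OF that] by (metis rangeI)
    have "j \<noteq> k" using False jk by blast
    moreover have pj: "p \<in> petal j" using False jk w by (auto simp: petal_def)
    moreover have qk: "q \<in> petal k" using False jk w by (auto simp: petal_def)
    moreover have "blind_at (A j) p"
      unfolding blind_at_def
    proof
      fix z assume z: "z \<in> A j"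
      then have "z \<in> petal j" using sub[OF jk(1)] by blast
      then have "z \<notin> petal k" using petals_disjoint[OF jk(1,3) \<open>j \<noteq> k\<close>] by blast
      then have "gdist B q z = gdist B q w + gdist B w z"
        using \<open>z \<in> petal j\<close> petal_subset_verts[OF jk(1)] by (intro gdist_through_w[OF jk(3) qk]) auto
      then show "gdist B p z = gdist B p w + gdist B w z"
        using eq[OF insertI1] eq[of z] UN_I[of j J z A] jk(1) z by simp
    qed
    moreover have "blind_at (A k) q"
      unfolding blind_at_def
    proof
      fix z assume z: "z \<in> A k"
      then have "z \<in> petal k" using sub[OF jk(3)] by blast
      then have "z \<notin> petal j" using petals_disjoint[OF jk(1,3) \<open>j \<noteq> k\<close>] by blast
      then have "gdist B p z = gdist B p w + gdist B w z"
        using \<open>z \<in> petal k\<close> petal_subset_verts[OF jk(3)] by (intro gdist_through_w[OF jk(1) pj]) auto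
      then show "gdist B q z = gdist B q w + gdist B w z"
        using eq[OF insertI1] eq[of z] UN_I[of k J z A] jk(3) z by simp
    qed
    ultimately show ?thesis using sighted[OF jk(1,3)] by blast
  qed
  have "Digraph_Component.connected (with_proj B \<restriction> ?S)"
  proof (rule connected_inducedI[OF sym_B, where f = "\<lambda>u. gdist B u w"])
    fix u assume "u \<in> ?S" "u \<noteq> w"
    then obtain j where "j \<in> J" "u \<in> A j" by blast
    then show "\<exists>v\<in>?S. (u, v) \<in> parcs B \<and> gdist B v w < gdist B u w"
      using descent by blast
  qed simp
  then show ?thesis using verts resolved
    unfolding connected_resolving_set_def resolving_set_def by blast
qed

lemma card_insert_petals:
  assumes "\<And>j. j \<in> J \<Longrightarrow> A j \<subseteq> petal j"
  shows "card (insert w (\<Union>j\<in>J. A j)) = Suc (\<Sum>j\<in>J. card (A j))"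
proof -
  have fin: "finite (A j)" if "j \<in> J" for j
    using assms[OF that] finite_petal[OF that] by (rule finite_subset)
  have "A j \<inter> A k = {}" if "j \<in> J" "k \<in> J" "j \<noteq> k" for j k
    using petals_disjoint[OF that] assms that by blast
  then have "card (\<Union>j\<in>J. A j) = (\<Sum>j\<in>J. card (A j))"
    using finite_J fin by (intro card_UN_disjoint) auto
  moreover have "w \<notin> (\<Union>j\<in>J. A j)" using assms w_notin_petal by blast
  moreover have "finite (\<Union>j\<in>J. A j)" using finite_J fin by blast
  ultimately show ?thesis by simp
qed

definition neighbours :: "'i \<Rightarrow> 'a set" where
  "neighbours j = {x j 1, x j (- 1)}"

lemma arc_from_w_descent:
  assumes j: "j \<in> J" and \<sigma>: "\<sigma> \<in> {1, - 1}" and d: "2 * int d \<le> n j" and u: "u \<in> arc_from_w j \<sigma> d"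
  shows "\<exists>v\<in>insert w (arc_from_w j \<sigma> d). (u, v) \<in> parcs B \<and> gdist B v w < gdist B u w"
proof -
  obtain t where t: "u = x j (\<sigma> * t)" "1 \<le> t" "t \<le> int d" using u by (auto simp: arc_from_w_def)
  let ?v = "x j (\<sigma> * (t - 1))"
  have "?v \<in> insert w (arc_from_w j \<sigma> d)"
  proof (cases "t = 1")
    case True
    then show ?thesis using x_0[OF j] by simp
  next
    case False
    then show ?thesis using t unfolding arc_from_w_def by (intro insertI2 imageI) auto
  qed
  moreover have "(u, ?v) \<in> parcs B"
    using arc_step[OF j \<sigma>, of "\<sigma> * t"] t(1) by (simp add: right_diff_distrib)
  moreover have "gdist B ?v w < gdist B u w"
    using gdist_arc_w(1)[OF j \<sigma>, of t] gdist_arc_w(1)[OF j \<sigma>, of "t - 1"] t d by simp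
  ultimately show ?thesis by blast
qed

lemma arc_from_w_subset:
  assumes j: "j \<in> J" and \<sigma>: "\<sigma> \<in> {1, - 1}" and d: "2 * int d \<le> n j"
  shows "arc_from_w j \<sigma> d \<subseteq> petal j"
proof
  fix u assume "u \<in> arc_from_w j \<sigma> d"
  then obtain t where t: "u = x j (\<sigma> * t)" "1 \<le> t" "t \<le> int d" by (auto simp: arc_from_w_def)
  have "gdist B u w = nat t" unfolding t(1) by (rule gdist_arc_w(1)[OF j \<sigma>]) (use t d in auto)
  moreover have "gdist B w w = 0" using gdist_w[OF j, of 0] x_0[OF j] by simp
  ultimately have "u \<noteq> w" using t by auto
  then show "u \<in> petal j" using t(1) by (auto simp: petal_def)
qed

text \<open>
  A path from a vertex of the petal through \<open>w\<close> to one at maximal distance from \<open>w\<close> is longer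
  than the diameter of the cycle.
\<close>
lemma not_blind_at_antipode:
  assumes j: "j \<in> J" and \<sigma>: "\<sigma> \<in> {1, - 1}" and d: "int d = n j div 2" and u: "u \<in> petal j"
  shows "\<not> blind_at (arc_from_w j \<sigma> d) u"
proof
  assume blind: "blind_at (arc_from_w j \<sigma> d) u"
  let ?z = "x j (\<sigma> * int d)"
  have "1 \<le> int d" "2 * int d \<le> n j" using d length_ge[OF j] by auto
  then have "?z \<in> arc_from_w j \<sigma> d" and z: "gdist B w ?z = d"
    using gdist_arc_w(2)[OF j \<sigma>, of "int d"] by (auto simp: arc_from_w_def)
  then have "gdist B u ?z = gdist B u w + d" using blind by (simp add: blind_at_def)
  moreover have "0 < gdist B u w" using petal_coordinate[OF j u] by metis
  moreover have "2 * int (gdist B u ?z) \<le> n j"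
    using gdist_le_half[OF j, of u ?z] u by (auto simp: petal_def)
  ultimately show False using d by auto
qed

text \<open>
  Each vertex has a neighbour of \<open>w\<close> on a shortest path to \<open>w\<close>.
\<close>
lemma not_blind_at_neighbours:
  assumes j: "j \<in> J" and u: "u \<in> petal j"
  shows "\<not> blind_at (neighbours j) u"
proof -
  obtain s d where s: "s \<in> {1, - 1}" "u = x j (s * int d)" "d = gdist B u w" "0 < d" "2 * int d \<le> n j"
    using petal_coordinate[OF j u] by metis
  have "gdist B u (x j s) = cdist (n j) (int d - 1)"
    using gdist_arc[OF j s(1), of "int d" 1] s(2) by simp
  also have "\<dots> < d" using s(4,5) by (subst cdist_small) auto
  finally have "gdist B u (x j s) < gdist B u w + gdist B w (x j s)" using s(3) by simp
  moreover have "x j s \<in> neighbours j" using s(1) by (auto simp: neighbours_def)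
  ultimately show ?thesis unfolding blind_at_def by fastforce
qed

lemma neighbours_descent:
  assumes j: "j \<in> J" and u: "u \<in> neighbours j"
  shows "\<exists>v\<in>insert w (neighbours j). (u, v) \<in> parcs B \<and> gdist B v w < gdist B u w"
proof -
  obtain s where s: "s \<in> {1, - 1}" "u = x j s" using u by (auto simp: neighbours_def)
  have "(u, w) \<in> parcs B" using arc_step[OF j s(1), of s] s(2) x_0[OF j] by simp
  moreover have "gdist B w w = 0" using gdist_w[OF j, of 0] x_0[OF j] by simp
  ultimately show ?thesis using neighbour_in_petal(2)[OF j s(1)] s(2) by auto
qed

lemma neighbours_subset: "j \<in> J \<Longrightarrow> neighbours j \<subseteq> petal j"
  using neighbour_in_petal(1) by (auto simp: neighbours_def)

lemma card_neighbours:
  assumes j: "j \<in> J"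
  shows "card (neighbours j) = 2"
proof -
  have "x j 1 \<noteq> x j (- 1)"
    using x_eq_iff[OF j, of 1 "- 1"] length_ge[OF j] zdvd_not_zless[of 2 "n j"] by auto
  then show ?thesis by (simp add: neighbours_def)
qed

text \<open>
  A set of \<open>quota j\<close> landmarks that leaves no vertex of the petal blind. On a triangle every
  vertex of the petal is at maximal distance from \<open>w\<close>.
\<close>
definition sighted_part :: "'i \<Rightarrow> 'a set" where
  "sighted_part j = (if n j = 3 then arc_from_w j 1 1 else neighbours j)"

lemma sighted_part:
  assumes j: "j \<in> J"
  shows "card (sighted_part j) = quota j" "u \<in> petal j \<Longrightarrow> \<not> blind_at (sighted_part j) u"
    "x j 1 \<in> sighted_part j" "sighted_part j \<subseteq> petal j"
    "u \<in> sighted_part j \<Longrightarrow> \<exists>v\<in>insert w (sighted_part j). (u, v) \<in> parcs B \<and> gdist B v w < gdist B u w"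
proof -
  have short: "2 * int 1 \<le> n j" using length_ge[OF j] by simp
  have one: "1 \<in> {1, - 1 :: int}" by simp
  note arc = card_arc_from_w[OF j one short] not_blind_at_antipode[OF j one, of 1 u]
    arc_from_w_subset[OF j one short] arc_from_w_descent[OF j one short, of u]
  note nbrs = card_neighbours[OF j] not_blind_at_neighbours[OF j, of u] neighbours_subset[OF j]
    neighbours_descent[OF j, of u]
  show "card (sighted_part j) = quota j" using arc(1) nbrs(1) by (simp add: sighted_part_def quota_def)
  show "u \<in> petal j \<Longrightarrow> \<not> blind_at (sighted_part j) u"
    using arc(2) nbrs(2) by (simp add: sighted_part_def)
  show "x j 1 \<in> sighted_part j" by (simp add: sighted_part_def arc_from_w_def neighbours_def)
  show "sighted_part j \<subseteq> petal j" using arc(3) nbrs(3) by (simp add: sighted_part_def)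
  show "u \<in> sighted_part j \<Longrightarrow>
      \<exists>v\<in>insert w (sighted_part j). (u, v) \<in> parcs B \<and> gdist B v w < gdist B u w"
    using arc(4) nbrs(4) unfolding sighted_part_def by presburger
qed

text \<open>
  The landmarks are an arc to \<open>v\<close> in its own petal and quota-sized sets elsewhere. If the arc reaches
  the far side of its cycle, no petal is blind so far, and one other long cycle may be
  reduced to a single landmark.
\<close>
lemma ex_connected_resolving:
  assumes i: "i \<in> J" and v: "v \<in> petal i"
  shows "\<exists>S. connected_resolving_set B S \<and> v \<in> S \<and> card S = cdim_through i (gdist B v w)"
proof -
  obtain \<sigma> d where \<sigma>: "\<sigma> \<in> {1, - 1}" "v = x i (\<sigma> * int d)" "d = gdist B v w" "0 < d" "2 * int d \<le> n i"
    using petal_coordinate[OF i v] by metis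
  \<comment> \<open>The long cycle reduced to one landmark, if there is one; \<open>SOME\<close> makes it unique.\<close>
  define spared where
    "spared = (\<lambda>e. int d = n i div 2 \<and> e = (SOME e. e \<in> J - {i} \<and> n e \<noteq> 3) \<and> e \<in> J - {i} \<and> n e \<noteq> 3)"
  have spared_unique: "e = e'" if "spared e" "spared e'" for e e'
    using that by (simp add: spared_def)
  define A where "A j = (if j = i then arc_from_w i \<sigma> d
    else if spared j then arc_from_w j 1 1 else sighted_part j)" for j
  have short: "2 * int 1 \<le> n j" if "j \<in> J" for j using length_ge[OF that] by simp
  have sub: "A j \<subseteq> petal j" if j: "j \<in> J" for j
    using arc_from_w_subset[OF i \<sigma>(1,5)] arc_from_w_subset[OF j _ short[OF j], of 1] sighted_part(4)[OF j]
    by (auto simp: A_def)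
  have crs: "connected_resolving_set B (insert w (\<Union>j\<in>J. A j))"
  proof (rule connected_resolvingI)
    show "J \<noteq> {}" using i by auto
    show "A j \<subseteq> petal j" if "j \<in> J" for j by (rule sub[OF that])
    show "\<exists>v\<in>insert w (A j). (u, v) \<in> parcs B \<and> gdist B v w < gdist B u w"
      if "j \<in> J" "u \<in> A j" for j u
      using that arc_from_w_descent[OF i \<sigma>(1,5), of u]
        arc_from_w_descent[OF that(1) _ short[OF that(1)], of 1 u] sighted_part(5)[OF that(1), of u]
      by (simp add: A_def split: if_splits)
    show "\<exists>s\<in>{1, - 1}. x j s \<in> A j" if j: "j \<in> J" for j
    proof (cases "j = i")
      case True
      have "x i (\<sigma> * 1) \<in> arc_from_w i \<sigma> d"
        unfolding arc_from_w_def by (rule imageI) (use \<sigma>(4) in auto)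
      then have "x j \<sigma> \<in> A j" using True by (simp add: A_def)
      then show ?thesis using \<sigma>(1) by auto
    next
      case False
      then have "x j 1 \<in> A j" using sighted_part(3)[OF j] by (simp add: A_def arc_from_w_def)
      then show ?thesis by auto
    qed
    fix j k u u' assume jk: "j \<in> J" "k \<in> J" "j \<noteq> k" "u \<in> petal j" "u' \<in> petal k"
      and blind: "blind_at (A j) u" "blind_at (A k) u'"
    \<comment> \<open>Only a short arc to \<open>v\<close> or the spared petal leaves blind vertices, and these two
      never occur together.\<close>
    have exception: "(l = i \<and> int d \<noteq> n i div 2) \<or> spared l"
      if l: "l \<in> J" "p \<in> petal l" "blind_at (A l) p" for l p
    proof (cases "l = i")
      case True
      then have "blind_at (arc_from_w i \<sigma> d) p" "p \<in> petal i" using l by (simp_all add: A_def)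
      then show ?thesis using True not_blind_at_antipode[OF i \<sigma>(1)] by blast
    next
      case False
      then show ?thesis using l(3) sighted_part(2)[OF l(1,2)] unfolding A_def by presburger
    qed
    have "spared l \<Longrightarrow> int d = n i div 2" for l by (simp add: spared_def)
    then show False
      using exception[OF jk(1,4) blind(1)] exception[OF jk(2,5) blind(2)] jk(3) spared_unique by blast
  qed
  have "card (insert w (\<Union>j\<in>J. A j)) = Suc (d + (\<Sum>j\<in>J - {i}. card (A j)))"
    using card_insert_petals[of A, OF sub] i finite_J card_arc_from_w[OF i \<sigma>(1,5)]
    by (simp add: sum.remove A_def)
  also have "\<dots> = cdim_through i d"
  proof (cases "int d = n i div 2 \<and> (\<exists>e\<in>J - {i}. n e \<noteq> 3)")
    case True
    define e where "e = (SOME e. e \<in> J - {i} \<and> n e \<noteq> 3)"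
    have e: "e \<in> J - {i}" "n e \<noteq> 3"
      using someI_ex[of "\<lambda>e. e \<in> J - {i} \<and> n e \<noteq> 3"] True unfolding e_def by blast+
    have spared: "spared j \<longleftrightarrow> j = e" for j
      using True e unfolding spared_def e_def[symmetric] by blast
    have fin: "finite (J - {i})" using finite_J by simp
    have "(\<Sum>j\<in>J - {i} - {e}. card (A j)) = (\<Sum>j\<in>J - {i} - {e}. quota j)"
      by (rule sum.cong) (auto simp: A_def spared sighted_part(1))
    moreover have "card (A e) = 1" using e card_arc_from_w[of e 1 1] short[of e] by (simp add: A_def spared)
    moreover have "quota e = 2" using e by (simp add: quota_def)
    ultimately show ?thesis
      using True sum.remove[OF fin e(1), of "\<lambda>j. card (A j)"] sum.remove[OF fin e(1), of quota]
      by (simp add: cdim_through_def)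
  next
    case False
    then have "\<not> spared j" for j unfolding spared_def by blast
    then have "(\<Sum>j\<in>J - {i}. card (A j)) = (\<Sum>j\<in>J - {i}. quota j)"
      by (intro sum.cong) (auto simp: A_def sighted_part(1))
    then show ?thesis unfolding cdim_through_def if_not_P[OF False] by simp
  qed
  finally have "card (insert w (\<Union>j\<in>J. A j)) = cdim_through i (gdist B v w)" using \<sigma>(3) by simp
  moreover have "v \<in> A i" using \<sigma>(2,4) by (auto simp: A_def arc_from_w_def)
  then have "v \<in> insert w (\<Union>j\<in>J. A j)" using i by blast
  ultimately show ?thesis using crs by blast
qed

section \<open>The connected metric dimension\<close>

lemma cdim_at_petal:
  assumes two: "i \<in> J" "k \<in> J" "i \<noteq> k" and v: "v \<in> petal i"
  shows "cdim_at B v = cdim_through i (gdist B v w)"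
  unfolding cdim_at_def
proof (rule Least_equality)
  show "\<exists>S. connected_resolving_set B S \<and> v \<in> S \<and> card S = cdim_through i (gdist B v w)"
    by (rule ex_connected_resolving[OF two(1) v])
next
  fix c assume "\<exists>S. connected_resolving_set B S \<and> v \<in> S \<and> card S = c"
  then obtain S where S: "connected_resolving_set B S" "v \<in> S" "card S = c" by blast
  then show "cdim_through i (gdist B v w) \<le> c"
    using card_ge_cdim_through[OF S(1) w_in_connected_resolving[OF S(1) two] two(1)] v by blast
qed

lemma cdim_through_min:
  assumes "0 < d"
  shows "cdim_through i 1 \<le> cdim_through i d"
proof (cases "d = 1")
  case False
  have "(if P then 0 else 1) \<le> (1 :: nat)" for P by simp
  then have "cdim_through i 1 \<le> 1 + (\<Sum>j\<in>J - {i}. quota j) + 1"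
    unfolding cdim_through_def by (rule add_left_mono)
  also have "\<dots> \<le> d + (\<Sum>j\<in>J - {i}. quota j)" using assms False by simp
  also have "\<dots> \<le> cdim_through i d" unfolding cdim_through_def by (rule le_add1)
  finally show ?thesis .
qed simp

text \<open>
  Any \<open>i\<close> will do: every connected resolving set has a vertex in the \<open>i\<close>-th petal, and
  neighbours of \<open>w\<close> are the cheapest ones.
\<close>
lemma cdim_eq:
  assumes two: "i \<in> J" "k \<in> J" "i \<noteq> k"
  shows "cdim B = cdim_through i 1"
  unfolding cdim_def
proof (rule Least_equality)
  have "x i 1 \<in> petal i" "gdist B (x i 1) w = 1" using neighbour_in_petal[OF two(1), of 1] by auto
  then show "\<exists>S. connected_resolving_set B S \<and> card S = cdim_through i 1"
    using ex_connected_resolving[OF two(1), of "x i 1"] by auto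
next
  fix c assume "\<exists>S. connected_resolving_set B S \<and> card S = c"
  then obtain S where S: "connected_resolving_set B S" "card S = c" by blast
  obtain v where v: "v \<in> S \<inter> petal i" using meets_petal[OF S(1) two(1)] by blast
  have "0 < gdist B v w" using petal_coordinate[OF two(1)] v by (metis IntD2)
  then have "cdim_through i 1 \<le> cdim_through i (gdist B v w)" by (rule cdim_through_min)
  also have "\<dots> \<le> card S"
    by (rule card_ge_cdim_through[OF S(1) w_in_connected_resolving[OF S(1) two] two(1) v])
  finally show "cdim_through i 1 \<le> c" using S(2) by simp
qed

lemma cdim_at_w:
  assumes two: "i \<in> J" "k \<in> J" "i \<noteq> k"
  shows "cdim_at B w = cdim B"
proof -
  have "connected_resolving_set B S \<and> w \<in> S \<and> card S = c \<longleftrightarrow>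
    connected_resolving_set B S \<and> card S = c" for S c
    using w_in_connected_resolving[OF _ two, of S] by blast
  then show ?thesis by (simp only: cdim_at_def cdim_def)
qed

lemma petal_closed_nbhd_iff:
  assumes i: "i \<in> J" and v: "v \<in> petal i"
  shows "v \<in> closed_nbhd B w \<longleftrightarrow> gdist B v w = 1"
proof
  assume "v \<in> closed_nbhd B w"
  then have "(v, w) \<in> parcs B" using v sym_B by (auto simp: closed_nbhd_def petal_def dest: symD)
  moreover obtain a where a: "v = x i a" "x i a \<noteq> w" using v by (auto simp: petal_def)
  ultimately consider "w = x i (a + 1)" | "w = x i (a - 1)" using arc_from_petal[OF i a(2)] by metis
  then have "v = x i (- 1) \<or> v = x i 1"
    using a(1) x_eq_w_iff[OF i] x_eq_iff[OF i] by cases auto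
  then show "gdist B v w = 1" using neighbour_in_petal(2)[OF i] by auto
next
  assume one: "gdist B v w = 1"
  obtain s d where s: "s \<in> {1, - 1}" and "v = x i (s * int d)" "d = gdist B v w"
    using petal_coordinate[OF i v] by metis
  then have "v = x i s" using one by simp
  then have "(v, w) \<in> parcs B" using arc_step[OF i s(1), of s] x_0[OF i] by simp
  then show "v \<in> closed_nbhd B w" using sym_B by (auto simp: closed_nbhd_def dest: symD)
qed

end

section \<open>Coordinates for a given bouquet\<close>

lemma is_cycle_coordinates:
  assumes "is_cycle k C" and w: "w \<in> pverts C"
  shows "\<exists>y :: int \<Rightarrow> 'a. y 0 = w \<and> (\<forall>a b. y a = y b \<longleftrightarrow> int k dvd a - b) \<and>
    pverts C = range y \<and> parcs C = {(y a, y b) | a b. b = a + 1 \<or> a = b + 1}"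
proof -
  obtain x where k: "3 \<le> k" and x: "bij_betw x {..<k} (pverts C)"
    and E: "parcs C = (\<Union>i<k. {(x i, x (Suc i mod k)), (x (Suc i mod k), x i)})"
    using assms(1) unfolding is_cycle_def by blast
  obtain p where p: "p < k" "x p = w"
    using w x by (metis bij_betw_def imageE lessThan_iff)
  define r where "r a = nat ((a + int p) mod int k)" for a
  have r_less: "r a < k" for a using k by (simp add: r_def nat_less_iff)
  have r_eq: "r a = r b \<longleftrightarrow> int k dvd a - b" for a b
    using k by (simp add: r_def eq_nat_nat_iff mod_eq_dvd_iff)
  have r_Suc: "r (a + 1) = Suc (r a) mod k" for a
  proof -
    have "int (Suc (r a) mod k) = ((a + int p) mod int k + 1) mod int k"
      using k by (simp add: r_def zmod_int add.commute)
    also have "\<dots> = (a + int p + 1) mod int k" by (rule mod_add_left_eq)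
    also have "a + int p + 1 = a + 1 + int p" by simp
    also have "(a + 1 + int p) mod int k = int (r (a + 1))" using k by (simp add: r_def)
    finally show ?thesis by simp
  qed
  have r_surj: "r (int i - int p) = i" if "i < k" for i using that by (simp add: r_def)
  define y where "y a = x (r a)" for a
  have inj: "x i = x j \<longleftrightarrow> i = j" if "i < k" "j < k" for i j
    using x that by (auto simp: bij_betw_def inj_on_def)
  show ?thesis
  proof (intro exI[of _ y] conjI allI)
    show "y 0 = w" using p by (simp add: y_def r_def)
    show "y a = y b \<longleftrightarrow> int k dvd a - b" for a b
      using inj[OF r_less r_less] r_eq by (simp add: y_def)
    have "range y = x ` {..<k}"
    proof
      show "range y \<subseteq> x ` {..<k}" using r_less by (auto simp: y_def)
      show "x ` {..<k} \<subseteq> range y"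
      proof
        fix u assume "u \<in> x ` {..<k}"
        then obtain i where "i < k" "u = x i" by auto
        then have "u = y (int i - int p)" using r_surj by (simp add: y_def)
        then show "u \<in> range y" by simp
      qed
    qed
    then show "pverts C = range y" using x by (simp add: bij_betw_def)
    have step: "y (a + 1) = x (Suc (r a) mod k)" for a by (simp add: y_def r_Suc)
    show "parcs C = {(y a, y b) | a b. b = a + 1 \<or> a = b + 1}"
    proof
      show "parcs C \<subseteq> {(y a, y b) | a b. b = a + 1 \<or> a = b + 1}"
      proof
        fix e assume "e \<in> parcs C"
        then obtain i where i: "i < k" "e = (x i, x (Suc i mod k)) \<or> e = (x (Suc i mod k), x i)"
          unfolding E by blast
        let ?a = "int i - int p"
        have "x i = y ?a" "x (Suc i mod k) = y (?a + 1)"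
          using r_surj[OF i(1)] step[of ?a] by (simp_all add: y_def)
        then show "e \<in> {(y a, y b) | a b. b = a + 1 \<or> a = b + 1}" using i(2) by auto
      qed
      show "{(y a, y b) | a b. b = a + 1 \<or> a = b + 1} \<subseteq> parcs C"
        unfolding E using r_less step by (auto simp: y_def)
    qed
  qed
qed

lemma is_cycle_card: "is_cycle k C \<Longrightarrow> card (pverts C) = k"
  unfolding is_cycle_def using bij_betw_same_card by fastforce

text \<open>
  A cycle is a bouquet with one petal, so its distances are those of \<open>gdist_same\<close>.
\<close>
lemma diam_cycle:
  assumes C: "is_cycle k C"
  shows "diam C = k div 2"
proof -
  have k: "3 \<le> k" using C by (simp add: is_cycle_def)
  then have "pverts C \<noteq> {}" using is_cycle_card[OF C] by auto
  then obtain w where w: "w \<in> pverts C" by blast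
  then obtain y :: "int \<Rightarrow> 'a" where y: "y 0 = w" "\<And>a b. y a = y b \<longleftrightarrow> int k dvd a - b"
    "pverts C = range y" "parcs C = {(y a, y b) | a b. b = a + 1 \<or> a = b + 1}"
    using is_cycle_coordinates[OF C w] by blast
  interpret cycle_bouquet C w "{()}" "\<lambda>_. int k" "\<lambda>_. y"
    by unfold_locales (use k y in auto)
  have dist: "gdist C (y a) (y b) = cdist (int k) (a - b)" for a b
    using gdist_same[of "()"] by simp
  have bound: "gdist C u v \<le> k div 2" if "u \<in> pverts C" "v \<in> pverts C" for u v
  proof -
    obtain a b where "u = y a" "v = y b" using \<open>u \<in> pverts C\<close> \<open>v \<in> pverts C\<close> y(3) by blast
    then show ?thesis using cdist_le_half[of "int k" "a - b"] k dist by simp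
  qed
  have "gdist C (y (int (k div 2))) (y 0) = k div 2"
    using cdist_small[of "int (k div 2)" "int k"] by (simp add: dist)
  then have "\<exists>u v. k div 2 = gdist C u v \<and> u \<in> pverts C \<and> v \<in> pverts C"
    using y(3) by (metis rangeI)
  then have "k div 2 \<in> {gdist C u v |u v. u \<in> pverts C \<and> v \<in> pverts C}" by simp
  moreover have "finite {gdist C u v |u v. u \<in> pverts C \<and> v \<in> pverts C}"
    by (rule finite_subset[of _ "{..k div 2}"]) (use bound in auto)
  ultimately show ?thesis unfolding diam_def by (intro Max_eqI) (use bound in auto)
qed

lemma bouquet_coordinates:
  assumes bq: "bouquet B w m C"
  obtains x where "cycle_bouquet B w {1..m} (\<lambda>j. int (card (pverts (C j)))) x"
    "\<And>j. j \<in> {1..m} \<Longrightarrow> pverts (C j) = range (x j)"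
proof -
  have cyc: "is_cycle (card (pverts (C j))) (C j)" "w \<in> pverts (C j)" if "j \<in> {1..m}" for j
    using bq is_cycle_card that unfolding bouquet_def by metis+
  have meet: "pverts (C i) \<inter> pverts (C j) = {w}" if "i \<in> {1..m}" "j \<in> {1..m}" "i \<noteq> j" for i j
    using bq that unfolding bouquet_def by blast
  have B: "pverts B = (\<Union>j\<in>{1..m}. pverts (C j))" "parcs B = (\<Union>j\<in>{1..m}. parcs (C j))"
    using bq unfolding bouquet_def by blast+
  have "\<forall>j\<in>{1..m}. \<exists>y :: int \<Rightarrow> 'a. y 0 = w \<and> (\<forall>a b. y a = y b \<longleftrightarrow> int (card (pverts (C j))) dvd a - b) \<and>
    pverts (C j) = range y \<and> parcs (C j) = {(y a, y b) | a b. b = a + 1 \<or> a = b + 1}"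
    using is_cycle_coordinates[OF cyc] by (rule ballI)
  from bchoice[OF this] obtain x :: "nat \<Rightarrow> int \<Rightarrow> 'a" where x: "\<And>j. j \<in> {1..m} \<Longrightarrow> x j 0 = w"
    "\<And>j a b. j \<in> {1..m} \<Longrightarrow> x j a = x j b \<longleftrightarrow> int (card (pverts (C j))) dvd a - b"
    "\<And>j. j \<in> {1..m} \<Longrightarrow> pverts (C j) = range (x j)"
    "\<And>j. j \<in> {1..m} \<Longrightarrow> parcs (C j) = {(x j a, x j b) | a b. b = a + 1 \<or> a = b + 1}"
    by blast
  show ?thesis
  proof (rule that)
    show "cycle_bouquet B w {1..m} (\<lambda>j. int (card (pverts (C j)))) x"
    proof
      show "3 \<le> int (card (pverts (C j)))" if "j \<in> {1..m}" for j
        using cyc[OF that] by (simp add: is_cycle_def)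
      show "x j a = w" if "j \<in> {1..m}" "k \<in> {1..m}" "j \<noteq> k" "x j a = x k b" for j k a b
        using meet[OF that(1-3)] x(3)[OF that(1)] x(3)[OF that(2)] that(4) by (metis Int_iff rangeI singletonD)
      show "pverts B = (\<Union>j\<in>{1..m}. range (x j))" using B(1) x(3) by auto
      show "parcs B = {(x j a, x j b) | j a b. j \<in> {1..m} \<and> (b = a + 1 \<or> a = b + 1)}"
        unfolding B(2) using x(4) by blast
    qed (use x in auto)
  qed (rule x(3))
qed

theorem corollary5p13:
  fixes B :: "'a pair_pre_digraph"
    and C :: "nat \<Rightarrow> 'a pair_pre_digraph"
    and w v :: 'a
    and m i b :: nat
    and \<Gamma> D :: "nat \<Rightarrow> 'a set"
  assumes "m \<ge> 2"
    and "bouquet B w m C"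
    and "b = card {j \<in> {1..m}. is_cycle 3 (C j)}"
    and "\<And>j. j \<in> {1..m} \<Longrightarrow> \<Gamma> j = pverts (C j) - closed_nbhd B w"
    and "\<And>j. j \<in> {1..m} \<Longrightarrow> D j = {u \<in> pverts (C j). gdist B u w = diam (C j)}"
    and "i \<in> {1..m}"
    and "v \<in> pverts (C i)"
  shows "(v \<in> closed_nbhd B w \<longrightarrow> cdim_at B v = cdim B) \<and>
    ((v \<in> \<Gamma> i \<and> b = m - 1) \<or> (v \<in> \<Gamma> i - D i \<and> b \<le> m - 2) \<longrightarrow>
      cdim_at B v = cdim B + gdist B v w - 1) \<and>
    (v \<in> \<Gamma> i \<inter> D i \<and> b \<le> m - 2 \<longrightarrow>
      cdim_at B v = cdim B + gdist B v w - 2)"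
proof -
  let ?n = "\<lambda>j. int (card (pverts (C j)))"
  obtain x where "cycle_bouquet B w {1..m} ?n x"
    and Cx: "\<And>j. j \<in> {1..m} \<Longrightarrow> pverts (C j) = range (x j)"
    using bouquet_coordinates[OF assms(2)] by blast
  then interpret cycle_bouquet B w "{1..m}" ?n x by simp
  note i = assms(6)
  obtain k where two: "i \<in> {1..m}" "k \<in> {1..m}" "i \<noteq> k"
  proof (cases "i = 1")
    case True
    then show ?thesis using that[of 2] i assms(1) by auto
  next
    case False
    then show ?thesis using that[of 1] i assms(1) by auto
  qed
  have cyc: "is_cycle (card (pverts (C j))) (C j)" if "j \<in> {1..m}" for j
    using assms(2) is_cycle_card that unfolding bouquet_def by metis
  have triangle: "is_cycle 3 (C j) \<longleftrightarrow> ?n j = 3" if "j \<in> {1..m}" for j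
  proof
    show "is_cycle 3 (C j) \<Longrightarrow> ?n j = 3" using is_cycle_card by fastforce
    show "?n j = 3 \<Longrightarrow> is_cycle 3 (C j)" using cyc[OF that] by simp
  qed
  have diam: "int (diam (C i)) = ?n i div 2" using diam_cycle[OF cyc[OF i]] by (simp add: zdiv_int)
  show ?thesis
  proof (cases "v = w")
    case True
    then have "v \<in> closed_nbhd B w" by (simp add: closed_nbhd_def)
    then show ?thesis using True cdim_at_w[OF two] assms(4)[OF i] by auto
  next
    case False
    let ?d = "gdist B v w"
    have v: "v \<in> petal i" using False assms(7) Cx[OF i] by (auto simp: petal_def)
    note at = cdim_at_petal[OF two v] and cdim = cdim_eq[OF two]
    have d: "0 < ?d" "2 * int ?d \<le> ?n i" using petal_coordinate[OF i v] by metis+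
    have far: "1 < ?d" if "v \<in> \<Gamma> i"
      using that d(1) assms(4)[OF i] petal_closed_nbhd_iff[OF i v] by auto
    have in_D: "v \<in> D i \<longleftrightarrow> int ?d = ?n i div 2"
    proof -
      have "v \<in> D i \<longleftrightarrow> ?d = diam (C i)" unfolding assms(5)[OF i] using assms(7) by simp
      also have "\<dots> \<longleftrightarrow> int ?d = int (diam (C i))" by simp
      finally show ?thesis unfolding diam .
    qed
    \<comment> \<open>The \<open>i\<close>-th cycle is not a triangle here, so \<open>b\<close> counts triangles among the other
      \<open>m - 1\<close> cycles.\<close>
    have others: "(\<exists>e\<in>{1..m} - {i}. ?n e \<noteq> 3) \<longleftrightarrow> b \<le> m - 2" if "v \<in> \<Gamma> i"
    proof -
      have "?n i \<noteq> 3" using far[OF that] d(2) by auto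
      then have b: "b = card {j \<in> {1..m} - {i}. ?n j = 3}"
        unfolding assms(3) using triangle by (intro arg_cong[of _ _ card]) auto
      have card: "card ({1..m} - {i}) = m - 1" using i by simp
      show ?thesis
      proof
        assume "\<exists>e\<in>{1..m} - {i}. ?n e \<noteq> 3"
        then have "{j \<in> {1..m} - {i}. ?n j = 3} \<subset> {1..m} - {i}" by blast
        then have "b < m - 1" unfolding b card[symmetric] by (intro psubset_card_mono) auto
        then show "b \<le> m - 2" by simp
      next
        assume "b \<le> m - 2"
        then have "b \<noteq> card ({1..m} - {i})" using card assms(1) by simp
        then have "{j \<in> {1..m} - {i}. ?n j = 3} \<noteq> {1..m} - {i}" unfolding b by metis
        then show "\<exists>e\<in>{1..m} - {i}. ?n e \<noteq> 3" by blast
      qed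
    qed
    have near: "cdim_at B v = cdim B" if "v \<in> closed_nbhd B w"
      using that petal_closed_nbhd_iff[OF i v] at cdim by simp
    have cdim2: "cdim B = (\<Sum>j\<in>{1..m} - {i}. quota j) + 2" if "v \<in> \<Gamma> i"
    proof -
      have "int 1 \<noteq> ?n i div 2" using far[OF that] d(2) by linarith
      then have "\<not> (int 1 = ?n i div 2 \<and> (\<exists>e\<in>{1..m} - {i}. ?n e \<noteq> 3))" by blast
      from cdim[unfolded cdim_through_def if_not_P[OF this]] show ?thesis by simp
    qed
    have "cdim_at B v = cdim B + ?d - 1"
      if "v \<in> \<Gamma> i \<and> b = m - 1 \<or> v \<in> \<Gamma> i - D i \<and> b \<le> m - 2"
    proof -
      have \<Gamma>: "v \<in> \<Gamma> i" using that by blast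
      have "b = m - 1 \<Longrightarrow> \<not> b \<le> m - 2" using assms(1) by linarith
      then have "\<not> (int ?d = ?n i div 2 \<and> (\<exists>e\<in>{1..m} - {i}. ?n e \<noteq> 3))"
        using that others[OF \<Gamma>] in_D by blast
      from at[unfolded cdim_through_def if_not_P[OF this]] show ?thesis
        using cdim2[OF \<Gamma>] by simp
    qed
    moreover have "cdim_at B v = cdim B + ?d - 2" if "v \<in> \<Gamma> i \<inter> D i \<and> b \<le> m - 2"
    proof -
      have \<Gamma>: "v \<in> \<Gamma> i" using that by blast
      have "int ?d = ?n i div 2 \<and> (\<exists>e\<in>{1..m} - {i}. ?n e \<noteq> 3)"
        using that others[OF \<Gamma>] in_D by blast
      from at[unfolded cdim_through_def if_P[OF this]] show ?thesis
        using cdim2[OF \<Gamma>] by simp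
    qed
    ultimately show ?thesis using near by blast
  qed
qed

end
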